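(* Under the reconfigurable semantics, with timing parameters ranging over all non-negative rationals (unbounded parameter domain), the $\exists$-EF-existence problem and the $\exists$-EF-universality problem are undecidable for parametric timed broadcast protocols with one clock.
   Context: A PTBP is a tuple $\mathcal N=(Q,X,\Sigma,P,q_0,\Delta)$ with finite states $Q$, finite clocks $X$, finite alphabet $\Sigma$, finite timing parameters $P$, initial state $q_0$, and finite edges $\Delta\subseteq Q\times G\times Act\times 2^X\times Q$, where a guard is a finite conjunction of constraints $x\bowtie a$ ($x\in X$, $\bowtie\in\{<,\le,=,\ge,>\}$, $a\in\mathbb Q_{\ge0}\cup P$), $Act=\{\epsilon\}\cup\{!!m,??m:m\in\Sigma\}$, and the subset of $X$ is the set of clocks reset. Clock valuations $v:X\to\mathbb R_{\ge0}$, parameter valuations $\pi:P\to\mathbb Q_{\ge0}$; $v\models_\pi g$ if all constraints hold with parameters replaced by their $\pi$-values. Semantics: for network size $N$, a configuration is a vector of $N$ (state, clock valuation) pairs, initially all $(q_0,\vec0)$. A transition under $\pi$: a delay $t\ge0$ is added to all clocks; a process $i$ takes an enabled edge $(q_1,g,a,U,q_2)$ (it is in $q_1$, clocks satisfy $g$ under $\pi$), moving to $q_2$ and resetting $U$; a receiver set $R\subseteq\{1,\dots,N\}$ is chosen; if $a=\epsilon$ others are unchanged; if $a=!!m$, each $j\in R\setminus\{i\}$ having an enabled edge labelled $??m$ from its current state takes one such edge, other processes are unchanged. In the reconfigurable semantics $R$ is arbitrary. Maximal executions (infinite, or ending where no transition is possible) from the initial configuration form $\mathcal E(\mathcal N,N,\pi)$;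 an execution reaches $q_f$ if some process is in $q_f$ at some configuration. Given $\mathcal N$ and $q_f$: $\exists$-EF-existence asks whether $\exists N\ \exists\pi\ \exists\rho\in\mathcal E(\mathcal N,N,\pi)$ reaching $q_f$; $\exists$-EF-universality asks whether $\exists N\ \forall\pi\ \exists\rho\in\mathcal E(\mathcal N,N,\pi)$ reaching $q_f$. *)

theory Defs
  imports Complex_Main "HOL-Library.Nat_Bijection" "HOL-Library.FuncSet"
begin

section \<open>Partial recursive functions and decision problems\<close>

datatype recf = Zero | Succ | Proj nat | Comp recf "recf list" | PrimRec recf recf | Mu recf

text \<open>\<open>computes f xs y\<close>: the partial recursive function denoted by \<open>f\<close> is defined on the argument
  tuple \<open>xs\<close> and has the value \<open>y\<close> there. Primitive recursion and minimisation act on the first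
  argument.\<close>

inductive computes :: "recf \<Rightarrow> nat list \<Rightarrow> nat \<Rightarrow> bool" where
  Zero: "computes Zero xs 0"
| Succ: "computes Succ [x] (Suc x)"
| Proj: "i < length xs \<Longrightarrow> computes (Proj i) xs (xs ! i)"
| Comp: "list_all2 (\<lambda>g y. computes g xs y) gs ys \<Longrightarrow> computes f ys z \<Longrightarrow>
    computes (Comp f gs) xs z"
| PrimRec_0: "computes f xs y \<Longrightarrow> computes (PrimRec f g) (0 # xs) y"
| PrimRec_Suc: "computes (PrimRec f g) (n # xs) r \<Longrightarrow> computes g (n # r # xs) y \<Longrightarrow>
    computes (PrimRec f g) (Suc n # xs) y"
| Mu: "computes f (n # xs) 0 \<Longrightarrow> (\<forall>k<n. \<exists>y. computes f (k # xs) (Suc y)) \<Longrightarrow>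
    computes (Mu f) xs n"

inductive_cases computes_elims:
  "computes Zero xs y"
  "computes Succ xs y"
  "computes (Proj i) xs y"
  "computes (Comp f gs) xs y"
  "computes (PrimRec f g) (0 # xs) y"
  "computes (PrimRec f g) (Suc n # xs) y"
  "computes (Mu f) xs y"

lemma computes_deterministic: "computes f xs y \<Longrightarrow> computes f xs z \<Longrightarrow> y = z"
proof (induction arbitrary: z rule: computes.induct)
  case (Zero xs)
  then show ?case by (rule computes_elims(1)) simp
next
  case (Succ x)
  then show ?case by (rule computes_elims(2)) simp
next
  case (Proj i xs)
  from Proj.prems show ?case by (rule computes_elims(3)) simp
next
  case (Comp xs gs ys f w)
  from Comp.prems obtain ys' where
    ys': "list_all2 (\<lambda>g y. computes g xs y) gs ys'" "computes f ys' z"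
    by (rule computes_elims(4))
  have "ys = ys'"
  proof (rule nth_equalityI)
    show "length ys = length ys'"
      using list_all2_lengthD[OF Comp.IH(1)] list_all2_lengthD[OF ys'(1)] by simp
    show "ys ! i = ys' ! i" if "i < length ys" for i
      using list_all2_nthD2[OF Comp.IH(1) that] list_all2_nthD[OF ys'(1), of i] that
        list_all2_lengthD[OF Comp.IH(1)] by simp
  qed
  with ys'(2) Comp.IH(2) show ?case by simp
next
  case (PrimRec_0 f xs y g)
  from PrimRec_0.prems have "computes f xs z" by (rule computes_elims(5))
  then show ?case by (rule PrimRec_0.IH)
next
  case (PrimRec_Suc f g n xs r y)
  from PrimRec_Suc.prems obtain r' where
    r': "computes (PrimRec f g) (n # xs) r'" "computes g (n # r' # xs) z"
    by (rule computes_elims(6))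
  from PrimRec_Suc.IH(1)[OF r'(1)] r'(2) PrimRec_Suc.IH(2) show ?case by simp
next
  case (Mu f n xs)
  from Mu.prems have z: "computes f (z # xs) 0" "\<forall>k<z. \<exists>y. computes f (k # xs) (Suc y)"
    by (auto elim!: computes_elims(7))
  show ?case
  proof (rule linorder_cases[of n z])
    assume "n < z"
    with z(2) obtain y where "computes f (n # xs) (Suc y)" by blast
    from Mu.IH(1)[OF this] show ?thesis by simp
  next
    assume "z < n"
    with Mu.IH(2) obtain y where "\<And>x. computes f (z # xs) x \<Longrightarrow> Suc y = x" by blast
    from this[OF z(1)] show ?thesis by simp
  qed
qed

text \<open>The problem with instance set \<open>I\<close> and question \<open>A\<close> is decidable if some algorithm answers
  correctly on the code of every instance. Nothing is asked of it on other numbers.\<close>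

definition decidable_problem :: "('a \<Rightarrow> nat) \<Rightarrow> 'a set \<Rightarrow> ('a \<Rightarrow> bool) \<Rightarrow> bool" where
  "decidable_problem enc I A \<longleftrightarrow>
     (\<exists>f. \<forall>x\<in>I. computes f [enc x] (if A x then 1 else 0))"


section \<open>Parametric timed broadcast protocols\<close>

datatype cmp = Lt | Le | Eq | Ge | Gt

datatype 'p bound = Const rat | Param 'p

type_synonym ('x, 'p) guard = "('x \<times> cmp \<times> 'p bound) list"

datatype 'm act = Eps | Bcast 'm | Recv 'm

type_synonym ('q, 'x, 'm, 'p) edge = "'q \<times> ('x, 'p) guard \<times> 'm act \<times> 'x set \<times> 'q"

record ('q, 'x, 'm, 'p) ptbp =
  states :: "'q set"
  clocks :: "'x set"
  alphabet :: "'m set"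
  params :: "'p set"
  init :: 'q
  edges :: "('q, 'x, 'm, 'p) edge set"

fun bound_in :: "'p set \<Rightarrow> 'p bound \<Rightarrow> bool" where
  "bound_in P (Const a) \<longleftrightarrow> 0 \<le> a"
| "bound_in P (Param p) \<longleftrightarrow> p \<in> P"

definition wf_edge :: "('q, 'x, 'm, 'p) ptbp \<Rightarrow> ('q, 'x, 'm, 'p) edge \<Rightarrow> bool" where
  "wf_edge \<N> = (\<lambda>(q, g, a, U, q').
     q \<in> states \<N> \<and> q' \<in> states \<N> \<and> U \<subseteq> clocks \<N> \<and> set_act a \<subseteq> alphabet \<N> \<and>
     (\<forall>(x, c, b)\<in>set g. x \<in> clocks \<N> \<and> bound_in (params \<N>) b))"

definition wf_ptbp :: "('q, 'x, 'm, 'p) ptbp \<Rightarrow> bool" where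
  "wf_ptbp \<N> \<longleftrightarrow>
     finite (states \<N>) \<and> finite (clocks \<N>) \<and> finite (alphabet \<N>) \<and> finite (params \<N>) \<and>
     init \<N> \<in> states \<N> \<and> finite (edges \<N>) \<and> (\<forall>e\<in>edges \<N>. wf_edge \<N> e)"


section \<open>Reconfigurable semantics\<close>

fun cmp_holds :: "cmp \<Rightarrow> real \<Rightarrow> real \<Rightarrow> bool" where
  "cmp_holds Lt s t \<longleftrightarrow> s < t"
| "cmp_holds Le s t \<longleftrightarrow> s \<le> t"
| "cmp_holds Eq s t \<longleftrightarrow> s = t"
| "cmp_holds Ge s t \<longleftrightarrow> s \<ge> t"
| "cmp_holds Gt s t \<longleftrightarrow> s > t"

fun bound_val :: "('p \<Rightarrow> rat) \<Rightarrow> 'p bound \<Rightarrow> rat" where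
  "bound_val \<pi> (Const a) = a"
| "bound_val \<pi> (Param p) = \<pi> p"

definition sat :: "('p \<Rightarrow> rat) \<Rightarrow> ('x \<Rightarrow> real) \<Rightarrow> ('x, 'p) guard \<Rightarrow> bool" where
  "sat \<pi> v g \<longleftrightarrow> (\<forall>(x, c, b)\<in>set g. cmp_holds c (v x) (of_rat (bound_val \<pi> b)))"

text \<open>Clock valuations are total functions; only their values on the clocks of the protocol
  are ever inspected.\<close>

type_synonym ('q, 'x) local = "'q \<times> ('x \<Rightarrow> real)"
type_synonym ('q, 'x) config = "('q, 'x) local list"

definition param_vals :: "('q, 'x, 'm, 'p) ptbp \<Rightarrow> ('p \<Rightarrow> rat) set" where
  "param_vals \<N> = params \<N> \<rightarrow> {0..}"

definition init_config :: "('q, 'x, 'm, 'p) ptbp \<Rightarrow> nat \<Rightarrow> ('q, 'x) config" where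
  "init_config \<N> N = replicate N (init \<N>, \<lambda>x. 0)"

definition delay :: "real \<Rightarrow> ('q, 'x) config \<Rightarrow> ('q, 'x) config" where
  "delay t C = map (\<lambda>(q, v). (q, \<lambda>x. v x + t)) C"

definition takes_edge ::
  "('q, 'x, 'm, 'p) ptbp \<Rightarrow> ('p \<Rightarrow> rat) \<Rightarrow> 'm act \<Rightarrow> ('q, 'x) local \<Rightarrow> ('q, 'x) local \<Rightarrow> bool" where
  "takes_edge \<N> \<pi> a l l' \<longleftrightarrow>
     (\<exists>g U. (fst l, g, a, U, fst l') \<in> edges \<N> \<and> sat \<pi> (snd l) g \<and>
       snd l' = (\<lambda>x. if x \<in> U then 0 else snd l x))"

text \<open>Processes are numbered from \<open>0\<close>. A selected process that has no enabled matching reception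
  edge ignores the message; one that has such an edge must take one. Reception edges are never
  taken on a process's own initiative.\<close>

inductive step ::
  "('q, 'x, 'm, 'p) ptbp \<Rightarrow> ('p \<Rightarrow> rat) \<Rightarrow> ('q, 'x) config \<Rightarrow> ('q, 'x) config \<Rightarrow> bool"
  for \<N> \<pi> where
  internal:
    "t \<ge> 0 \<Longrightarrow> D = delay t C \<Longrightarrow> length C' = length C \<Longrightarrow> i < length C \<Longrightarrow>
     takes_edge \<N> \<pi> Eps (D ! i) (C' ! i) \<Longrightarrow>
     (\<forall>j<length C. j \<noteq> i \<longrightarrow> C' ! j = D ! j) \<Longrightarrow>
     step \<N> \<pi> C C'"
| broadcast:
    "t \<ge> 0 \<Longrightarrow> D = delay t C \<Longrightarrow> length C' = length C \<Longrightarrow> i < length C \<Longrightarrow>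
     R \<subseteq> {..<length C} \<Longrightarrow>
     takes_edge \<N> \<pi> (Bcast m) (D ! i) (C' ! i) \<Longrightarrow>
     (\<forall>j<length C. j \<noteq> i \<longrightarrow>
        (if j \<in> R \<and> (\<exists>l. takes_edge \<N> \<pi> (Recv m) (D ! j) l)
         then takes_edge \<N> \<pi> (Recv m) (D ! j) (C' ! j)
         else C' ! j = D ! j)) \<Longrightarrow>
     step \<N> \<pi> C C'"

datatype ('q, 'x) execution = Fin "('q, 'x) config list" | Inf "nat \<Rightarrow> ('q, 'x) config"

fun max_exec ::
  "('q, 'x, 'm, 'p) ptbp \<Rightarrow> nat \<Rightarrow> ('p \<Rightarrow> rat) \<Rightarrow> ('q, 'x) execution \<Rightarrow> bool" where
  "max_exec \<N> N \<pi> (Fin Cs) \<longleftrightarrow>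
     Cs \<noteq> [] \<and> hd Cs = init_config \<N> N \<and>
     (\<forall>k. Suc k < length Cs \<longrightarrow> step \<N> \<pi> (Cs ! k) (Cs ! Suc k)) \<and>
     \<not> (\<exists>C. step \<N> \<pi> (last Cs) C)"
| "max_exec \<N> N \<pi> (Inf Cs) \<longleftrightarrow>
     Cs 0 = init_config \<N> N \<and> (\<forall>k. step \<N> \<pi> (Cs k) (Cs (Suc k)))"

definition executions ::
  "('q, 'x, 'm, 'p) ptbp \<Rightarrow> nat \<Rightarrow> ('p \<Rightarrow> rat) \<Rightarrow> ('q, 'x) execution set" where
  "executions \<N> N \<pi> = {\<rho>. max_exec \<N> N \<pi> \<rho>}"

fun configs :: "('q, 'x) execution \<Rightarrow> ('q, 'x) config set" where
  "configs (Fin Cs) = set Cs"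
| "configs (Inf Cs) = range Cs"

definition reaches :: "('q, 'x) execution \<Rightarrow> 'q \<Rightarrow> bool" where
  "reaches \<rho> q \<longleftrightarrow> (\<exists>C\<in>configs \<rho>. q \<in> fst ` set C)"

definition EF_existence :: "('q, 'x, 'm, 'p) ptbp \<times> 'q \<Rightarrow> bool" where
  "EF_existence = (\<lambda>(\<N>, qf).
     \<exists>N. \<exists>\<pi>\<in>param_vals \<N>. \<exists>\<rho>\<in>executions \<N> N \<pi>. reaches \<rho> qf)"

definition EF_universality :: "('q, 'x, 'm, 'p) ptbp \<times> 'q \<Rightarrow> bool" where
  "EF_universality = (\<lambda>(\<N>, qf).
     \<exists>N. \<forall>\<pi>\<in>param_vals \<N>. \<exists>\<rho>\<in>executions \<N> N \<pi>. reaches \<rho> qf)"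


section \<open>Instances and their codes\<close>

text \<open>As inputs of an algorithm, protocols have natural numbers as names of states, clocks, messages
  and parameters.\<close>

type_synonym nptbp = "(nat, nat, nat, nat) ptbp"

definition one_clock_instances :: "(nptbp \<times> nat) set" where
  "one_clock_instances = {(\<N>, qf). wf_ptbp \<N> \<and> card (clocks \<N>) = 1 \<and> qf \<in> states \<N>}"

fun cmp_code :: "cmp \<Rightarrow> nat" where
  "cmp_code Lt = 0" | "cmp_code Le = 1" | "cmp_code Eq = 2" | "cmp_code Ge = 3" | "cmp_code Gt = 4"

fun bound_code :: "nat bound \<Rightarrow> nat" where
  "bound_code (Const a) =
     2 * (case quotient_of a of (m, n) \<Rightarrow> prod_encode (int_encode m, int_encode n))"
| "bound_code (Param p) = 2 * p + 1"

fun act_code :: "nat act \<Rightarrow> nat" where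
  "act_code Eps = 0"
| "act_code (Bcast m) = 2 * m + 1"
| "act_code (Recv m) = 2 * m + 2"

definition guard_code :: "(nat, nat) guard \<Rightarrow> nat" where
  "guard_code g =
     list_encode (map (\<lambda>(x, c, b). prod_encode (x, prod_encode (cmp_code c, bound_code b))) g)"

definition edge_code :: "(nat, nat, nat, nat) edge \<Rightarrow> nat" where
  "edge_code = (\<lambda>(q, g, a, U, q').
     list_encode [q, guard_code g, act_code a, set_encode U, q'])"

definition instance_code :: "nptbp \<times> nat \<Rightarrow> nat" where
  "instance_code = (\<lambda>(\<N>, qf).
     list_encode [set_encode (states \<N>), set_encode (clocks \<N>), set_encode (alphabet \<N>),
       set_encode (params \<N>), init \<N>, set_encode (edge_code ` edges \<N>), qf])"

lemma cmp_code_inject: "cmp_code c = cmp_code c' \<longleftrightarrow> c = c'"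
  by (cases c; cases c'; simp)

lemma bound_code_inject: "bound_code b = bound_code b' \<longleftrightarrow> b = b'"
proof (cases b; cases b')
  fix a a' assume b: "b = Const a" "b' = Const a'"
  obtain m n m' n' where "quotient_of a = (m, n)" "quotient_of a' = (m', n')"
    by (metis surj_pair)
  with b quotient_of_inject_eq[of a a'] show ?thesis
    by (simp add: prod_encode_eq int_encode_eq)
next
  fix a p assume "b = Const a" "b' = Param p"
  moreover have "2 * k \<noteq> 2 * p + 1" for k :: nat by presburger
  ultimately show ?thesis by simp
next
  fix p a assume "b = Param p" "b' = Const a"
  moreover have "2 * p + 1 \<noteq> 2 * k" for k :: nat by presburger
  ultimately show ?thesis by simp
qed simp

lemma act_code_inject: "act_code a = act_code a' \<longleftrightarrow> a = a'"
proof -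
  have "Suc (2 * m) \<noteq> 2 * n + 2" "2 * n + 2 \<noteq> Suc (2 * m)" for m n :: nat by presburger+
  then show ?thesis by (cases a; cases a') auto
qed

lemma guard_code_inject: "guard_code g = guard_code g' \<longleftrightarrow> g = g'"
proof -
  have "inj (\<lambda>(x, c, b). prod_encode (x, prod_encode (cmp_code c, bound_code b)))"
    by (auto simp: inj_def prod_encode_eq cmp_code_inject bound_code_inject)
  then show ?thesis
    by (simp add: guard_code_def list_encode_eq inj_map_eq_map)
qed

lemma inj_on_edge_code: "inj_on edge_code {(q, g, a, U, q'). finite U}"
  by (rule inj_onI) (auto simp: edge_code_def list_encode_eq guard_code_inject act_code_inject
      set_encode_eq simp del: list_encode.simps)

lemma inj_on_instance_code: "inj_on instance_code one_clock_instances"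
proof (rule inj_onI, clarify)
  fix \<N> \<N>' :: nptbp and q q' :: nat
  assume I: "(\<N>, q) \<in> one_clock_instances" "(\<N>', q') \<in> one_clock_instances"
    and eq: "instance_code (\<N>, q) = instance_code (\<N>', q')"
  have wf: "wf_ptbp \<N>" "wf_ptbp \<N>'"
    using I by (simp_all add: one_clock_instances_def)
  have sub: "edges \<M> \<subseteq> {(q, g, a, U, q'). finite U}" if "wf_ptbp \<M>" for \<M> :: nptbp
  proof
    fix e assume "e \<in> edges \<M>"
    with that show "e \<in> {(q, g, a, U, q'). finite U}"
      by (cases e) (auto simp: wf_ptbp_def wf_edge_def dest: finite_subset)
  qed
  have codes: "set_encode (states \<N>) = set_encode (states \<N>')"
    "set_encode (clocks \<N>) = set_encode (clocks \<N>')"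
    "set_encode (alphabet \<N>) = set_encode (alphabet \<N>')"
    "set_encode (params \<N>) = set_encode (params \<N>')" "init \<N> = init \<N>'"
    "set_encode (edge_code ` edges \<N>) = set_encode (edge_code ` edges \<N>')" "q = q'"
    using eq by (simp_all add: instance_code_def list_encode_eq del: list_encode.simps)
  have fin: "finite (states \<M>)" "finite (clocks \<M>)" "finite (alphabet \<M>)" "finite (params \<M>)"
    "finite (edge_code ` edges \<M>)" if "wf_ptbp \<M>" for \<M> :: nptbp
    using that by (simp_all add: wf_ptbp_def)
  have "edge_code ` edges \<N> = edge_code ` edges \<N>'"
    using codes(6) fin(5)[OF wf(1)] fin(5)[OF wf(2)] by (simp only: set_encode_eq)
  then have "edges \<N> = edges \<N>'"
    using inj_on_image_eq_iff[OF inj_on_edge_code sub[OF wf(1)] sub[OF wf(2)]] by simp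
  moreover have "states \<N> = states \<N>'" "clocks \<N> = clocks \<N>'" "alphabet \<N> = alphabet \<N>'"
    "params \<N> = params \<N>'"
    using codes(1-4) fin(1-4)[OF wf(1)] fin(1-4)[OF wf(2)] by (simp_all only: set_encode_eq)
  ultimately show "\<N> = \<N>' \<and> q = q'"
    using codes(5,7) by simp
qed

end

theory Submission
  imports Defs "HOL-Library.Countable"
begin

text \<open>A counter machine run is simulated by one-clock processes: a controller, and one process per
  counter. With the parameter \<open>p\<close> and the input \<open>n\<close>, the \<open>k\<close>-th instruction is executed at time
  \<open>n + k (p + 1)\<close>, when the clock of a counter process shows the value of its counter. Until the next
  instruction, the process resets its clock at \<open>p\<close>, and then once more after \<open>0\<close>, \<open>1\<close> or \<open>2\<close> time
  units, to increment, keep or decrement the value. As guards fix the time of every move, a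
  process that has missed a message never again meets the others at the right time; hence neither
  losses nor several processes with the same role can falsify the simulation. Values of at least
  \<open>p\<close> block the simulation, and a step counter reports this overflow. So the halting state
  is reachable for some \<open>p\<close> iff the machine halts, and the overflow state is reachable for all \<open>p\<close>
  iff it does not.

  The input occurs only in the guard \<open>x = n\<close> of a single edge. The number \<open>A\<close> that codes the set
  of the other edges therefore describes the instance for every input, and the code of the instance
  with input \<open>A\<close> is computable from \<open>A\<close>. A decision algorithm could be asked about this
  instance by the simulated machine itself, which then does the opposite.\<close>

section \<open>Closure properties of computable functions\<close>

definition computable :: "nat \<Rightarrow> (nat list \<Rightarrow> nat) \<Rightarrow> bool" where
  "computable k h \<longleftrightarrow> (\<exists>f. \<forall>xs. length xs = k \<longrightarrow> computes f xs (h xs))"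

lemma computes_compI:
  assumes "length gs = length ys" "\<And>i. i < length gs \<Longrightarrow> computes (gs ! i) xs (ys ! i)"
    and "computes f ys z"
  shows "computes (Comp f gs) xs z"
  by (rule computes.Comp[of xs gs ys]) (use assms in \<open>auto simp: list_all2_conv_all_nth\<close>)

lemma computes_comp1:
  "computes g xs y \<Longrightarrow> computes f [y] z \<Longrightarrow> computes (Comp f [g]) xs z"
  by (rule computes_compI[of "[g]" "[y]"]) auto

lemma computable_proj: "i < k \<Longrightarrow> computable k (\<lambda>xs. xs ! i)"
  unfolding computable_def by (intro exI[of _ "Proj i"]) (auto intro: computes.Proj)

lemma computable_comp1:
  assumes "computable 1 (\<lambda>xs. h (xs ! 0))" "computable k u"
  shows "computable k (\<lambda>xs. h (u xs))"
proof -
  obtain f g where f: "\<And>xs. length xs = 1 \<Longrightarrow> computes f xs (h (xs ! 0))"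
    and g: "\<And>xs. length xs = k \<Longrightarrow> computes g xs (u xs)"
    using assms unfolding computable_def by metis
  have "computes (Comp f [g]) xs (h (u xs))" if "length xs = k" for xs
    using computes_comp1[OF g[OF that], of f] f[of "[u xs]"] by simp
  then show ?thesis unfolding computable_def by blast
qed

lemma computable_comp2:
  assumes "computable 2 (\<lambda>xs. h (xs ! 0) (xs ! 1))" "computable k u" "computable k v"
  shows "computable k (\<lambda>xs. h (u xs) (v xs))"
proof -
  obtain f g g' where f: "\<And>xs. length xs = 2 \<Longrightarrow> computes f xs (h (xs ! 0) (xs ! 1))"
    and g: "\<And>xs. length xs = k \<Longrightarrow> computes g xs (u xs)"
    and g': "\<And>xs. length xs = k \<Longrightarrow> computes g' xs (v xs)"
    using assms unfolding computable_def by metis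
  have "computes (Comp f [g, g']) xs (h (u xs) (v xs))" if "length xs = k" for xs
    by (rule computes_compI[of _ "[u xs, v xs]"])
      (use f[of "[u xs, v xs]"] g[OF that] g'[OF that] in \<open>auto simp: less_Suc_eq\<close>)
  then show ?thesis unfolding computable_def by blast
qed

lemma computable_Suc: "computable k u \<Longrightarrow> computable k (\<lambda>xs. Suc (u xs))"
proof (rule computable_comp1[of Suc])
  have "computes Succ xs (Suc (xs ! 0))" if "length xs = 1" for xs
    using that by (cases xs) (auto intro: computes.Succ)
  then show "computable 1 (\<lambda>xs. Suc (xs ! 0))" unfolding computable_def by blast
qed

lemma computable_const: "computable k (\<lambda>_. c)"
proof (induction c)
  case 0
  show ?case unfolding computable_def by (intro exI[of _ Zero]) (auto intro: computes.Zero)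
qed (rule computable_Suc)

text \<open>Parameter-free recursion, with a constant of arity 0 as base. It covers triangular
  numbers, powers of 2 and codes of initial segments.\<close>

lemma computable_rec:
  assumes "\<And>n. h (Suc n) = u n (h n)" "computable 2 (\<lambda>xs. u (xs ! 0) (xs ! 1))"
  shows "computable 1 (\<lambda>xs. h (xs ! 0))"
proof -
  obtain g where g: "\<And>xs. length xs = 2 \<Longrightarrow> computes g xs (u (xs ! 0) (xs ! 1))"
    using assms(2) unfolding computable_def by metis
  obtain b where b: "computes b [] (h 0)"
    using computable_const[of 0 "h 0"] unfolding computable_def by auto
  have "computes (PrimRec b g) [n] (h n)" for n
  proof (induction n)
    case (Suc n)
    with g[of "[n, h n]"] show ?case by (auto intro: computes.PrimRec_Suc simp: assms(1))
  qed (rule computes.PrimRec_0[OF b])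
  then have "computes (PrimRec b g) xs (h (xs ! 0))" if "length xs = 1" for xs
    using that by (cases xs) auto
  then show ?thesis unfolding computable_def by blast
qed

lemma computable_add:
  assumes "computable k u" "computable k v"
  shows "computable k (\<lambda>xs. u xs + v xs)"
proof (rule computable_comp2[OF _ assms])
  \<comment> \<open>\<open>PrimRec_Suc\<close> passes the predecessor first and the recursive value
    second, so \<open>Proj 1\<close> selects the latter.\<close>
  have g: "computes (Comp Succ [Proj 1]) [n, r, b] (Suc r)" for n r b
    using computes_comp1[OF computes.Proj[of 1 "[n, r, b]"] computes.Succ] by simp
  have "computes (PrimRec (Proj 0) (Comp Succ [Proj 1])) [a, b] (a + b)" for a b
  proof (induction a)
    case 0
    show ?case using computes.Proj[of 0 "[b]"] by (auto intro: computes.PrimRec_0)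
  next
    case (Suc a)
    then show ?case using computes.PrimRec_Suc[OF _ g] by simp
  qed
  then have "computes (PrimRec (Proj 0) (Comp Succ [Proj 1])) xs (xs ! 0 + xs ! 1)"
    if "length xs = 2" for xs
    using that by (auto simp: numeral_2_eq_2 length_Suc_conv)
  then show "computable 2 (\<lambda>xs. xs ! 0 + xs ! 1)" unfolding computable_def by blast
qed

section \<open>Computability of the codings of pairs, sets and lists\<close>

lemma computable_prod_encode:
  assumes "computable k u" "computable k v"
  shows "computable k (\<lambda>xs. prod_encode (u xs, v xs))"
proof -
  have "computable 1 (\<lambda>xs. triangle (xs ! 0))"
    by (rule computable_rec[of triangle "\<lambda>n r. r + Suc n"])
      (auto intro!: computable_add computable_Suc computable_proj)
  from computable_comp1[OF this]
  show ?thesis by (simp add: prod_encode_def computable_add assms)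
qed

lemma computable_pow2:
  assumes "computable k u"
  shows "computable k (\<lambda>xs. 2 ^ u xs)"
  by (rule computable_comp1[OF _ assms], rule computable_rec[of "\<lambda>n. 2 ^ n" "\<lambda>n r. r + r"])
    (auto intro!: computable_add computable_proj)

text \<open>Serves the state set and the alphabet of \<open>proto\<close>, which are initial
  segments so that their codes can be computed from the endpoint.\<close>

lemma computable_set_encode_atMost:
  assumes "computable k u"
  shows "computable k (\<lambda>xs. set_encode {..u xs})"
proof (rule computable_comp1[OF _ assms],
    rule computable_rec[of "\<lambda>n. set_encode {..n}" "\<lambda>n r. r + 2 ^ Suc n"])
  show "set_encode {..Suc n} = set_encode {..n} + 2 ^ Suc n" for n
    by (simp add: set_encode_def)
  show "computable 2 (\<lambda>xs. xs ! 1 + 2 ^ Suc (xs ! 0))"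
    by (intro computable_add computable_pow2 computable_Suc computable_proj) auto
qed

lemma computable_list_encode_Nil: "computable k (\<lambda>xs. list_encode [])"
  by (rule computable_const)

lemma computable_list_encode_Cons:
  "computable k u \<Longrightarrow> computable k (\<lambda>xs. list_encode (v xs)) \<Longrightarrow>
    computable k (\<lambda>xs. list_encode (u xs # v xs))"
  by (auto intro: computable_Suc computable_prod_encode)

section \<open>Partial recursive functions on counter machines\<close>

datatype com = Skip | Inc nat | Seq com com | Loop nat com

text \<open>\<open>Loop r c\<close> is a while loop that decrements \<open>r\<close> before each
  pass. As \<open>c\<close> may raise \<open>r\<close> again, unbounded search is
  expressible.\<close>

inductive exec :: "com \<Rightarrow> (nat \<Rightarrow> nat) \<Rightarrow> (nat \<Rightarrow> nat) \<Rightarrow> bool" where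
  Skip: "exec Skip \<sigma> \<sigma>"
| Inc: "exec (Inc r) \<sigma> (\<sigma>(r := Suc (\<sigma> r)))"
| Seq: "exec c \<sigma> \<sigma>' \<Longrightarrow> exec d \<sigma>' \<sigma>'' \<Longrightarrow> exec (Seq c d) \<sigma> \<sigma>''"
| Loop_0: "\<sigma> r = 0 \<Longrightarrow> exec (Loop r c) \<sigma> \<sigma>"
| Loop_Suc: "\<sigma> r = Suc v \<Longrightarrow> exec c (\<sigma>(r := v)) \<sigma>' \<Longrightarrow> exec (Loop r c) \<sigma>' \<sigma>'' \<Longrightarrow>
    exec (Loop r c) \<sigma> \<sigma>''"

definition clear :: "nat \<Rightarrow> com" where
  "clear r = Loop r Skip"

text \<open>Reading a register by a loop empties it, so the value is moved to \<open>t\<close> and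
  from there both back to \<open>r\<close> and on to \<open>d\<close>.\<close>

definition copy :: "nat \<Rightarrow> nat \<Rightarrow> nat \<Rightarrow> com" where
  "copy r d t = Seq (clear d) (Seq (clear t) (Seq (Loop r (Inc t)) (Loop t (Seq (Inc r) (Inc d)))))"

lemma exec_clear: "exec (clear r) \<sigma> (\<sigma>(r := 0))"
  unfolding clear_def
proof (induction "\<sigma> r" arbitrary: \<sigma>)
  case 0
  then show ?case by (metis Loop_0 fun_upd_triv)
next
  case (Suc v)
  have "exec (Loop r Skip) (\<sigma>(r := v)) (\<sigma>(r := 0))"
    using Suc(1)[of "\<sigma>(r := v)"] by simp
  with Suc(2) show ?case by (metis Loop_Suc exec.Skip)
qed

lemma exec_move:
  assumes "r \<noteq> t"
  shows "exec (Loop r (Inc t)) \<sigma> (\<sigma>(t := \<sigma> t + \<sigma> r, r := 0))"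
proof (induction "\<sigma> r" arbitrary: \<sigma>)
  case 0
  then have "\<sigma>(t := \<sigma> t + \<sigma> r, r := 0) = \<sigma>" by (auto simp: fun_eq_iff)
  with 0 show ?case by (metis Loop_0)
next
  case (Suc v)
  have "exec (Loop r (Inc t)) (\<sigma>(r := v, t := Suc (\<sigma> t))) (\<sigma>(t := \<sigma> t + \<sigma> r, r := 0))"
    using Suc(1)[of "\<sigma>(r := v, t := Suc (\<sigma> t))"] Suc(2)[symmetric] assms
    by (simp add: fun_upd_twist fun_upd_upd)
  moreover have "exec (Inc t) (\<sigma>(r := v)) (\<sigma>(r := v, t := Suc (\<sigma> t)))"
    using exec.Inc[of t "\<sigma>(r := v)"] assms by simp
  ultimately show ?case using Suc(2) by (metis Loop_Suc)
qed

lemma exec_move2: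
  assumes "t \<noteq> r" "t \<noteq> d" "r \<noteq> d"
  shows "exec (Loop t (Seq (Inc r) (Inc d))) \<sigma> (\<sigma>(r := \<sigma> r + \<sigma> t, d := \<sigma> d + \<sigma> t, t := 0))"
proof (induction "\<sigma> t" arbitrary: \<sigma>)
  case 0
  then have "\<sigma>(r := \<sigma> r + \<sigma> t, d := \<sigma> d + \<sigma> t, t := 0) = \<sigma>" by (auto simp: fun_eq_iff)
  with 0 show ?case by (metis Loop_0)
next
  case (Suc v)
  let ?\<tau> = "\<sigma>(t := v, r := Suc (\<sigma> r), d := Suc (\<sigma> d))"
  have "?\<tau>(r := ?\<tau> r + ?\<tau> t, d := ?\<tau> d + ?\<tau> t, t := 0) =
      \<sigma>(r := \<sigma> r + \<sigma> t, d := \<sigma> d + \<sigma> t, t := 0)"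
    using assms Suc(2)[symmetric] by (auto simp: fun_eq_iff)
  then have "exec (Loop t (Seq (Inc r) (Inc d))) ?\<tau> (\<sigma>(r := \<sigma> r + \<sigma> t, d := \<sigma> d + \<sigma> t, t := 0))"
    using Suc(1)[of ?\<tau>] assms by (metis fun_upd_other fun_upd_same)
  moreover have "exec (Seq (Inc r) (Inc d)) (\<sigma>(t := v)) ?\<tau>"
    using exec.Seq[OF exec.Inc[of r "\<sigma>(t := v)"] exec.Inc[of d]] assms by simp
  ultimately show ?case using Suc(2) by (metis Loop_Suc)
qed

lemma exec_copy:
  assumes "t \<noteq> r" "t \<noteq> d" "r \<noteq> d"
  shows "exec (copy r d t) \<sigma> (\<sigma>(d := \<sigma> r, t := 0))"
proof -
  let ?\<sigma>1 = "\<sigma>(d := 0, t := 0)"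
  let ?\<sigma>2 = "?\<sigma>1(t := \<sigma> r, r := 0)"
  have "exec (Loop r (Inc t)) ?\<sigma>1 ?\<sigma>2"
    using exec_move[of r t ?\<sigma>1] assms by simp
  moreover have "?\<sigma>2(r := ?\<sigma>2 r + ?\<sigma>2 t, d := ?\<sigma>2 d + ?\<sigma>2 t, t := 0) = \<sigma>(d := \<sigma> r, t := 0)"
    using assms by (auto simp: fun_eq_iff)
  then have "exec (Loop t (Seq (Inc r) (Inc d))) ?\<sigma>2 (\<sigma>(d := \<sigma> r, t := 0))"
    using exec_move2[OF assms, of ?\<sigma>2] by simp
  ultimately show ?thesis
    unfolding copy_def by (blast intro: exec.Seq exec_clear)
qed

section \<open>Compilation of partial recursive functions to programs\<close>

definition agree :: "nat \<Rightarrow> nat set \<Rightarrow> (nat \<Rightarrow> nat) \<Rightarrow> (nat \<Rightarrow> nat) \<Rightarrow> bool" where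
  "agree k D \<sigma> \<sigma>' \<longleftrightarrow> (\<forall>r<k. r \<notin> D \<longrightarrow> \<sigma>' r = \<sigma> r)"

text \<open>Registers from \<open>k\<close> on are scratch space, with arbitrary contents before and after.\<close>

definition implements :: "recf \<Rightarrow> nat list \<Rightarrow> nat \<Rightarrow> nat \<Rightarrow> com \<Rightarrow> bool" where
  "implements f rs d k c \<longleftrightarrow> (\<forall>\<sigma> y. computes f (map \<sigma> rs) y \<longrightarrow>
     (\<exists>\<sigma>'. exec c \<sigma> \<sigma>' \<and> \<sigma>' d = y \<and> agree k {d} \<sigma> \<sigma>'))"

lemma implementsD:
  assumes "implements f rs d k c" "computes f xs y" "map \<sigma> rs = xs"
  obtains \<sigma>' where "exec c \<sigma> \<sigma>'" "\<sigma>' d = y" "agree k {d} \<sigma> \<sigma>'"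
  using assms unfolding implements_def by blast

text \<open>The induction over \<open>f\<close> must be free to place arguments and result in any
  registers below \<open>k\<close>. The destination is not an argument, because \<open>copy\<close>
  needs distinct registers.\<close>

definition implementable :: "recf \<Rightarrow> bool" where
  "implementable f \<longleftrightarrow>
     (\<forall>rs d k. d < k \<longrightarrow> set rs \<subseteq> {..<k} \<longrightarrow> d \<notin> set rs \<longrightarrow> (\<exists>c. implements f rs d k c))"

lemma implementableD:
  "implementable f \<Longrightarrow> d < k \<Longrightarrow> set rs \<subseteq> {..<k} \<Longrightarrow> d \<notin> set rs \<Longrightarrow> \<exists>c. implements f rs d k c"
  unfolding implementable_def by blast

lemma implementable_Comp:
  assumes f: "implementable f" and gs: "\<And>g. g \<in> set gs \<Longrightarrow> implementable g"
  shows "implementable (Comp f gs)"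
  unfolding implementable_def
proof (intro allI impI)
  fix rs :: "nat list" and d k :: nat
  assume d: "d < k" and rs: "set rs \<subseteq> {..<k}" "d \<notin> set rs"
  \<comment> \<open>The values of the inner functions go into consecutive registers from
    \<open>j\<close> on. Scratch space moves up by one register each time, so that later
    computations preserve earlier results.\<close>
  have args: "\<exists>c. \<forall>(\<sigma> :: nat \<Rightarrow> nat) ys. list_all2 (\<lambda>g y. computes g (map \<sigma> rs) y) hs ys \<longrightarrow>
      (\<exists>\<sigma>'. exec c \<sigma> \<sigma>' \<and> map \<sigma>' [j..<j + length hs] = ys \<and> agree j {} \<sigma> \<sigma>')"
    if "k \<le> j" "set hs \<subseteq> set gs" for hs j
    using that
  proof (induction hs arbitrary: j)
    case Nil
    show ?case by (intro exI[of _ Skip]) (auto simp: agree_def intro: exec.Skip)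
  next
    case (Cons g hs)
    from Cons.IH[of "Suc j"] Cons.prems obtain c' where
      c': "\<And>\<sigma> ys. list_all2 (\<lambda>g y. computes g (map \<sigma> rs) y) hs ys \<Longrightarrow>
        \<exists>\<sigma>'. exec c' \<sigma> \<sigma>' \<and> map \<sigma>' [Suc j..<Suc j + length hs] = ys \<and> agree (Suc j) {} \<sigma> \<sigma>'"
      by auto
    have "set rs \<subseteq> {..<Suc j}" "j \<notin> set rs" "implementable g"
      using rs Cons.prems gs by auto
    then obtain c where c: "implements g rs j (Suc j) c"
      unfolding implementable_def by blast
    show ?case
    proof (intro exI[of _ "Seq c c'"] allI impI)
      fix \<sigma> ys assume "list_all2 (\<lambda>g y. computes g (map \<sigma> rs) y) (g # hs) ys"
      then obtain y ys' where ys: "ys = y # ys'" "computes g (map \<sigma> rs) y"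
        "list_all2 (\<lambda>g y. computes g (map \<sigma> rs) y) hs ys'"
        by (auto simp: list_all2_Cons1)
      obtain \<sigma>1 where s1: "exec c \<sigma> \<sigma>1" "\<sigma>1 j = y" "agree (Suc j) {j} \<sigma> \<sigma>1"
        using implementsD[OF c ys(2) refl] by blast
      have "map \<sigma>1 rs = map \<sigma> rs"
        using s1(3) rs Cons.prems(1) by (force simp: agree_def)
      then have "list_all2 (\<lambda>g y. computes g (map \<sigma>1 rs) y) hs ys'" using ys(3) by metis
      then obtain \<sigma>2 where s2: "exec c' \<sigma>1 \<sigma>2" "map \<sigma>2 [Suc j..<Suc j + length hs] = ys'"
        "agree (Suc j) {} \<sigma>1 \<sigma>2"
        using c' by blast
      have "exec (Seq c c') \<sigma> \<sigma>2" using s1(1) s2(1) by (rule exec.Seq)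
      moreover have "map \<sigma>2 [j..<j + length (g # hs)] = ys"
        using s2(2,3) s1(2) by (simp add: ys(1) upt_conv_Cons agree_def del: upt_Suc)
      moreover have "agree j {} \<sigma> \<sigma>2"
        using s1(3) s2(3) by (auto simp: agree_def)
      ultimately show "\<exists>\<sigma>'. exec (Seq c c') \<sigma> \<sigma>' \<and> map \<sigma>' [j..<j + length (g # hs)] = ys \<and>
          agree j {} \<sigma> \<sigma>'" by blast
    qed
  qed
  let ?m = "k + length gs"
  obtain c where c: "\<And>\<sigma> ys. list_all2 (\<lambda>g y. computes g (map \<sigma> rs) y) gs ys \<Longrightarrow>
      \<exists>\<sigma>'. exec c \<sigma> \<sigma>' \<and> map \<sigma>' [k..<?m] = ys \<and> agree k {} \<sigma> \<sigma>'"
    using args[of k gs] by auto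
  obtain c' where c': "implements f [k..<?m] d ?m c'"
    using implementableD[OF f, of d ?m "[k..<?m]"] d by fastforce
  have "implements (Comp f gs) rs d k (Seq c c')"
    unfolding implements_def
  proof (intro allI impI)
    fix \<sigma> z assume "computes (Comp f gs) (map \<sigma> rs) z"
    then obtain ys where ys: "list_all2 (\<lambda>g y. computes g (map \<sigma> rs) y) gs ys" "computes f ys z"
      by (rule computes_elims(4))
    obtain \<sigma>1 where s1: "exec c \<sigma> \<sigma>1" "map \<sigma>1 [k..<?m] = ys" "agree k {} \<sigma> \<sigma>1"
      using c[OF ys(1)] by blast
    obtain \<sigma>2 where s2: "exec c' \<sigma>1 \<sigma>2" "\<sigma>2 d = z" "agree ?m {d} \<sigma>1 \<sigma>2"
      using implementsD[OF c' ys(2) s1(2)] by blast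
    have "agree k {d} \<sigma> \<sigma>2" using s1(3) s2(3) by (auto simp: agree_def)
    then show "\<exists>\<sigma>'. exec (Seq c c') \<sigma> \<sigma>' \<and> \<sigma>' d = z \<and> agree k {d} \<sigma> \<sigma>'"
      using exec.Seq[OF s1(1) s2(1)] s2(2) by blast
  qed
  then show "\<exists>c. implements (Comp f gs) rs d k c" by blast
qed

lemma implementable_PrimRec:
  assumes f: "implementable f" and g: "implementable g"
  shows "implementable (PrimRec f g)"
  unfolding implementable_def
proof (intro allI impI)
  fix rs :: "nat list" and d k :: nat
  assume d: "d < k" and rs: "set rs \<subseteq> {..<k}" "d \<notin> set rs"
  show "\<exists>c. implements (PrimRec f g) rs d k c"
  proof (cases rs)
    case Nil
    \<comment> \<open>Vacuous: primitive recursion has no value on the empty tuple.\<close>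
    have "implements (PrimRec f g) rs d k Skip"
      unfolding implements_def Nil by (auto elim: computes.cases)
    then show ?thesis by blast
  next
    case (Cons r rs')
    \<comment> \<open>\<open>?i\<close> counts the finished rounds, \<open>?acc\<close> holds the
      value at \<open>?i\<close>, and \<open>?rem\<close> the number of rounds left. The next value
      is first put into \<open>?new\<close>, because \<open>?acc\<close> is an argument of
      \<open>g\<close> and cannot be its destination.\<close>
    let ?i = k and ?acc = "k + 1" and ?rem = "k + 2" and ?new = "k + 3" and ?s = "k + 4"
    have r: "r < k" "r \<noteq> d" and rs': "set rs' \<subseteq> {..<k}" using rs Cons by auto
    have "\<exists>c. implements f rs' ?acc ?s c"
      using rs' by (intro implementableD[OF f]) auto
    moreover have "\<exists>c. implements g (?i # ?acc # rs') ?new ?s c"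
      using rs' by (intro implementableD[OF g]) auto
    ultimately obtain cf cg where cf: "implements f rs' ?acc ?s cf"
      and cg: "implements g (?i # ?acc # rs') ?new ?s cg" by blast
    define body where "body = Seq cg (Seq (copy ?new ?acc ?s) (Inc ?i))"
    define c where "c = Seq (copy r ?rem ?s) (Seq (clear ?i) (Seq cf
      (Seq (Loop ?rem body) (copy ?acc d ?s))))"
    have loop: "\<exists>\<sigma>'. exec (Loop ?rem body) \<sigma> \<sigma>' \<and> \<sigma>' ?acc = y \<and> agree k {} \<sigma> \<sigma>'"
      if "computes (PrimRec f g) (n # xs) y" "computes (PrimRec f g) (\<sigma> ?i # xs) (\<sigma> ?acc)"
        "map \<sigma> rs' = xs" "n = \<sigma> ?i + \<sigma> ?rem" for \<sigma> :: "nat \<Rightarrow> nat" and n xs y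
      using that
    proof (induction "\<sigma> ?rem" arbitrary: \<sigma>)
      case 0
      then have "\<sigma> ?acc = y" using computes_deterministic by auto
      with 0(1) show ?case by (auto intro!: exI[of _ \<sigma>] Loop_0 simp: agree_def)
    next
      case (Suc v)
      let ?\<sigma>0 = "\<sigma>(?rem := v)"
      have "\<exists>z. computes (PrimRec f g) (Suc (\<sigma> ?i) # xs) z"
      proof -
        \<comment> \<open>A value at \<open>Suc m\<close> can only be derived from one at
          \<open>m\<close>, so definedness descends from \<open>n\<close>.\<close>
        have "\<exists>z. computes (PrimRec f g) (j # xs) z" if "j \<le> n" for j
          using that
        proof (induction rule: inc_induct)
          case base
          show ?case using Suc.prems(1) by blast
        next
          case (step m)
          then show ?case by (metis computes_elims(6))
        qed
        then show ?thesis using Suc.prems(4) Suc.hyps(2) by simp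
      qed
      then obtain z where z: "computes (PrimRec f g) (Suc (\<sigma> ?i) # xs) z" by blast
      then obtain a where "computes (PrimRec f g) (\<sigma> ?i # xs) a" "computes g (\<sigma> ?i # a # xs) z"
        by (rule computes_elims(6))
      then have gz: "computes g (\<sigma> ?i # \<sigma> ?acc # xs) z"
        using computes_deterministic[OF Suc.prems(2)] by simp
      have "map ?\<sigma>0 rs' = xs" using Suc.prems(3) rs' by (auto simp: map_eq_conv)
      then obtain \<sigma>1 where s1: "exec cg ?\<sigma>0 \<sigma>1" "\<sigma>1 ?new = z" "agree ?s {?new} ?\<sigma>0 \<sigma>1"
        using implementsD[OF cg gz, of ?\<sigma>0] by auto
      let ?\<sigma>2 = "\<sigma>1(?acc := z, ?s := 0)"
      let ?\<sigma>3 = "?\<sigma>2(?i := Suc (\<sigma> ?i))"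
      have s2: "exec (copy ?new ?acc ?s) \<sigma>1 ?\<sigma>2"
        using exec_copy[of ?s ?new ?acc \<sigma>1] s1(2) by simp
      have i: "\<sigma>1 ?i = \<sigma> ?i" "\<sigma>1 ?rem = v" using s1(3) by (auto simp: agree_def)
      have s3: "exec (Inc ?i) ?\<sigma>2 ?\<sigma>3"
        using exec.Inc[of ?i ?\<sigma>2] i by simp
      have low: "agree k {} \<sigma> ?\<sigma>3" using s1(3) by (auto simp: agree_def)
      have ex: "exec body ?\<sigma>0 ?\<sigma>3"
        unfolding body_def using s1(1) s2 s3 by (blast intro: exec.Seq)
      have "map ?\<sigma>3 rs' = map \<sigma> rs'"
        using low rs' by (auto simp: agree_def subset_iff)
      then obtain \<sigma>' where s': "exec (Loop ?rem body) ?\<sigma>3 \<sigma>'" "\<sigma>' ?acc = y" "agree k {} ?\<sigma>3 \<sigma>'"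
        using Suc.hyps(1)[of ?\<sigma>3, OF _ Suc.prems(1) _ \<open>map ?\<sigma>3 rs' = map \<sigma> rs'\<close>[unfolded Suc.prems(3)]]
          Suc.prems(4) Suc.hyps(2) i z by force
      have "exec (Loop ?rem body) \<sigma> \<sigma>'"
        using Loop_Suc[OF Suc.hyps(2)[symmetric] ex s'(1)] .
      moreover have "agree k {} \<sigma> \<sigma>'" using s'(3) low by (auto simp: agree_def)
      ultimately show ?case using s'(2) by blast
    qed
    have "implements (PrimRec f g) rs d k c"
      unfolding implements_def
    proof (intro allI impI)
      fix \<sigma> y assume "computes (PrimRec f g) (map \<sigma> rs) y"
      then have y: "computes (PrimRec f g) (\<sigma> r # map \<sigma> rs') y" using Cons by simp
      let ?\<sigma>1 = "\<sigma>(?rem := \<sigma> r, ?s := 0)"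
      let ?\<sigma>2 = "?\<sigma>1(?i := 0)"
      have s1: "exec (copy r ?rem ?s) \<sigma> ?\<sigma>1" using r by (intro exec_copy) auto
      have s2: "exec (clear ?i) ?\<sigma>1 ?\<sigma>2" by (rule exec_clear)
      have "\<exists>z. computes (PrimRec f g) (j # map \<sigma> rs') z" if "j \<le> \<sigma> r" for j
        using that
      proof (induction rule: inc_induct)
        case base
        show ?case using y by blast
      next
        case (step m)
        then show ?case by (metis computes_elims(6))
      qed
      then obtain z where z: "computes (PrimRec f g) (0 # map \<sigma> rs') z" by blast
      then have fz: "computes f (map \<sigma> rs') z" by (rule computes_elims(5))
      have "map ?\<sigma>2 rs' = map \<sigma> rs'" using rs' by auto
      then obtain \<sigma>3 where s3: "exec cf ?\<sigma>2 \<sigma>3" "\<sigma>3 ?acc = z" "agree ?s {?acc} ?\<sigma>2 \<sigma>3"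
        using implementsD[OF cf fz] by blast
      have "map \<sigma>3 rs' = map \<sigma> rs'" using s3(3) rs' by (force simp: agree_def)
      then obtain \<sigma>4 where s4: "exec (Loop ?rem body) \<sigma>3 \<sigma>4" "\<sigma>4 ?acc = y" "agree k {} \<sigma>3 \<sigma>4"
        using loop[OF y, of \<sigma>3] s3 z by (auto simp: agree_def)
      let ?\<sigma>5 = "\<sigma>4(d := y, ?s := 0)"
      have s5: "exec (copy ?acc d ?s) \<sigma>4 ?\<sigma>5"
        using exec_copy[of ?s ?acc d \<sigma>4] d s4(2) by simp
      have "exec c \<sigma> ?\<sigma>5"
        unfolding c_def using s1 s2 s3(1) s4(1) s5 by (blast intro: exec.Seq)
      moreover have "agree k {d} \<sigma> ?\<sigma>5" using s3(3) s4(3) by (auto simp: agree_def)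
      ultimately show "\<exists>\<sigma>'. exec c \<sigma> \<sigma>' \<and> \<sigma>' d = y \<and> agree k {d} \<sigma> \<sigma>'"
        using d by (intro exI[of _ ?\<sigma>5]) auto
    qed
    then show ?thesis by blast
  qed
qed

lemma implementable_Mu:
  assumes f: "implementable f"
  shows "implementable (Mu f)"
  unfolding implementable_def
proof (intro allI impI)
  fix rs :: "nat list" and d k :: nat
  assume d: "d < k" and rs: "set rs \<subseteq> {..<k}" "d \<notin> set rs"
  let ?i = k and ?res = "k + 1" and ?s = "k + 2"
  have "\<exists>c. implements f (?i # rs) ?res ?s c"
    using rs by (intro implementableD[OF f]) auto
  then obtain cf where cf: "implements f (?i # rs) ?res ?s cf" by blast
  \<comment> \<open>\<open>cf\<close> runs once before the loop and again at the end of each pass.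
    That the loop decrements \<open>?res\<close> does no harm, as \<open>cf\<close> overwrites it
    before the next test.\<close>
  define c where "c = Seq (clear ?i) (Seq cf (Seq (Loop ?res (Seq (Inc ?i) cf)) (copy ?i d ?s)))"
  have loop: "\<exists>\<sigma>'. exec (Loop ?res (Seq (Inc ?i) cf)) \<sigma> \<sigma>' \<and> \<sigma>' ?i = n \<and> agree k {} \<sigma> \<sigma>'"
    if "computes f (n # xs) 0" "\<forall>j<n. \<exists>y. computes f (j # xs) (Suc y)"
      "computes f (\<sigma> ?i # xs) (\<sigma> ?res)" "\<sigma> ?i \<le> n" "map \<sigma> rs = xs" for \<sigma> :: "nat \<Rightarrow> nat" and n xs
    using that
  proof (induction "n - \<sigma> ?i" arbitrary: \<sigma>)
    case 0
    then have "\<sigma> ?i = n" by simp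
    with 0 have "\<sigma> ?res = 0" using computes_deterministic by auto
    with \<open>\<sigma> ?i = n\<close> show ?case by (auto intro!: exI[of _ \<sigma>] Loop_0 simp: agree_def)
  next
    case (Suc m)
    then have lt: "\<sigma> ?i < n" by simp
    with Suc.prems(2) obtain y where "computes f (\<sigma> ?i # xs) (Suc y)" by blast
    with Suc.prems(3) have res: "\<sigma> ?res = Suc y" using computes_deterministic by blast
    have "\<exists>z. computes f (Suc (\<sigma> ?i) # xs) z"
      using lt Suc.prems(1,2) by (metis Suc_lessI)
    then obtain z where z: "computes f (Suc (\<sigma> ?i) # xs) z" by blast
    let ?\<sigma>1 = "\<sigma>(?res := y, ?i := Suc (\<sigma> ?i))"
    have s1: "exec (Inc ?i) (\<sigma>(?res := y)) ?\<sigma>1"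
      using exec.Inc[of ?i "\<sigma>(?res := y)"] by simp
    have "map ?\<sigma>1 (?i # rs) = Suc (\<sigma> ?i) # xs"
      using Suc.prems(5) rs by fastforce
    then obtain \<sigma>2 where s2: "exec cf ?\<sigma>1 \<sigma>2" "\<sigma>2 ?res = z" "agree ?s {?res} ?\<sigma>1 \<sigma>2"
      using implementsD[OF cf z, of ?\<sigma>1] by metis
    have i: "\<sigma>2 ?i = Suc (\<sigma> ?i)" using s2(3) by (auto simp: agree_def)
    have low: "agree k {} \<sigma> \<sigma>2" using s2(3) by (auto simp: agree_def)
    have "map \<sigma>2 rs = xs" using low rs Suc.prems(5) by (force simp: agree_def)
    then obtain \<sigma>' where s': "exec (Loop ?res (Seq (Inc ?i) cf)) \<sigma>2 \<sigma>'" "\<sigma>' ?i = n"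
      "agree k {} \<sigma>2 \<sigma>'"
      using Suc.hyps(1)[of \<sigma>2, OF _ Suc.prems(1,2) _ _ \<open>map \<sigma>2 rs = xs\<close>] Suc.hyps(2) i z s2(2) lt
      by force
    have "exec (Loop ?res (Seq (Inc ?i) cf)) \<sigma> \<sigma>'"
      using Loop_Suc[OF res exec.Seq[OF s1 s2(1)] s'(1)] .
    moreover have "agree k {} \<sigma> \<sigma>'" using s'(3) low by (auto simp: agree_def)
    ultimately show ?case using s'(2) by blast
  qed
  have "implements (Mu f) rs d k c"
    unfolding implements_def
  proof (intro allI impI)
    fix \<sigma> n assume "computes (Mu f) (map \<sigma> rs) n"
    then have n: "computes f (n # map \<sigma> rs) 0" "\<forall>j<n. \<exists>y. computes f (j # map \<sigma> rs) (Suc y)"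
      by (auto elim!: computes_elims(7))
    have "\<exists>z. computes f (0 # map \<sigma> rs) z" using n by (metis neq0_conv)
    then obtain z where z: "computes f (0 # map \<sigma> rs) z" by blast
    let ?\<sigma>1 = "\<sigma>(?i := 0)"
    have s1: "exec (clear ?i) \<sigma> ?\<sigma>1" by (rule exec_clear)
    have "map ?\<sigma>1 (?i # rs) = 0 # map \<sigma> rs" using rs by auto
    then obtain \<sigma>2 where s2: "exec cf ?\<sigma>1 \<sigma>2" "\<sigma>2 ?res = z" "agree ?s {?res} ?\<sigma>1 \<sigma>2"
      using implementsD[OF cf z, of ?\<sigma>1] by metis
    have i: "\<sigma>2 ?i = 0" "map \<sigma>2 rs = map \<sigma> rs" using s2(3) rs by (force simp: agree_def)+
    obtain \<sigma>3 where s3: "exec (Loop ?res (Seq (Inc ?i) cf)) \<sigma>2 \<sigma>3" "\<sigma>3 ?i = n" "agree k {} \<sigma>2 \<sigma>3"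
      using loop[OF n, of \<sigma>2] i z s2(2) by auto
    let ?\<sigma>4 = "\<sigma>3(d := n, ?s := 0)"
    have s4: "exec (copy ?i d ?s) \<sigma>3 ?\<sigma>4"
      using exec_copy[of ?s ?i d \<sigma>3] d s3(2) by simp
    have "exec c \<sigma> ?\<sigma>4"
      unfolding c_def using s1 s2(1) s3(1) s4 by (blast intro: exec.Seq)
    moreover have "agree k {d} \<sigma> ?\<sigma>4" using s2(3) s3(3) by (auto simp: agree_def)
    ultimately show "\<exists>\<sigma>'. exec c \<sigma> \<sigma>' \<and> \<sigma>' d = n \<and> agree k {d} \<sigma> \<sigma>'"
      using d by (intro exI[of _ ?\<sigma>4]) auto
  qed
  then show "\<exists>c. implements (Mu f) rs d k c" by blast
qed

lemma implementable: "implementable f"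
proof (induction f)
  case Zero
  have "implements Zero rs d k (clear d)" for rs d k
    unfolding implements_def
    by (auto elim!: computes_elims(1) intro!: exI[of _ "_(d := 0)"] exec_clear simp: agree_def)
  then show ?case unfolding implementable_def by blast
next
  case Succ
  \<comment> \<open>\<open>Succ\<close> has values on tuples of length 1 only, so
    \<open>hd rs\<close> is the argument in every case to be checked. The temporary \<open>k\<close>
    is the first scratch register.\<close>
  have "implements Succ rs d k (Seq (copy (hd rs) d k) (Inc d))"
    if "d < k" "set rs \<subseteq> {..<k}" "d \<notin> set rs" for rs d k
    unfolding implements_def
  proof (intro allI impI)
    fix \<sigma> y assume "computes Succ (map \<sigma> rs) y"
    then obtain r where r: "rs = [r]" "y = Suc (\<sigma> r)" by (auto elim!: computes_elims(2))
    have "exec (copy (hd rs) d k) \<sigma> (\<sigma>(d := \<sigma> r, k := 0))"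
      using exec_copy[of k r d \<sigma>] that r by auto
    from exec.Seq[OF this exec.Inc] show "\<exists>\<sigma>'. exec (Seq (copy (hd rs) d k) (Inc d)) \<sigma> \<sigma>' \<and>
        \<sigma>' d = y \<and> agree k {d} \<sigma> \<sigma>'"
      using that r by (fastforce simp: agree_def)
  qed
  then show ?case unfolding implementable_def by blast
next
  case (Proj i)
  have "implements (Proj i) rs d k (copy (rs ! i) d k)"
    if "d < k" "set rs \<subseteq> {..<k}" "d \<notin> set rs" for rs d k
    unfolding implements_def
  proof (intro allI impI)
    fix \<sigma> y assume "computes (Proj i) (map \<sigma> rs) y"
    then have i: "i < length rs" "y = \<sigma> (rs ! i)" by (auto elim!: computes_elims(3))
    then have "rs ! i \<in> set rs" by simp
    then have "exec (copy (rs ! i) d k) \<sigma> (\<sigma>(d := \<sigma> (rs ! i), k := 0))"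
      using that by (intro exec_copy) auto
    then show "\<exists>\<sigma>'. exec (copy (rs ! i) d k) \<sigma> \<sigma>' \<and> \<sigma>' d = y \<and> agree k {d} \<sigma> \<sigma>'"
      using that i by (fastforce simp: agree_def)
  qed
  then show ?case unfolding implementable_def by blast
qed (auto intro: implementable_Comp implementable_PrimRec implementable_Mu)

section \<open>Counter machines with jumps\<close>

datatype instr = INC nat nat | JMP nat | JZD nat nat nat

text \<open>Configurations outside the program are fixed points. Thus runs are total, and halting
  means leaving the program.\<close>

fun mnext :: "instr list \<Rightarrow> nat \<times> (nat \<Rightarrow> nat) \<Rightarrow> nat \<times> (nat \<Rightarrow> nat)" where
  "mnext P (i, \<sigma>) =
     (if i < length P then
        case P ! i of
          INC r b \<Rightarrow> (b, \<sigma>(r := Suc (\<sigma> r)))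
        | JMP b \<Rightarrow> (b, \<sigma>)
        | JZD r a b \<Rightarrow> if \<sigma> r = 0 then (a, \<sigma>) else (b, \<sigma>(r := \<sigma> r - 1))
      else (i, \<sigma>))"

fun clen :: "com \<Rightarrow> nat" where
  "clen Skip = 0"
| "clen (Inc r) = 1"
| "clen (Seq c d) = clen c + clen d"
| "clen (Loop r c) = clen c + 2"

text \<open>\<open>a\<close> is the absolute address of the first instruction. Control leaves the
  code at \<open>a + clen c\<close>, so pieces can be concatenated.\<close>

fun compile :: "nat \<Rightarrow> com \<Rightarrow> instr list" where
  "compile a Skip = []"
| "compile a (Inc r) = [INC r (a + 1)]"
| "compile a (Seq c d) = compile a c @ compile (a + clen c) d"
| "compile a (Loop r c) = JZD r (a + clen c + 2) (a + 1) # compile (a + 1) c @ [JMP a]"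

lemma length_compile: "length (compile a c) = clen c"
  by (induction c arbitrary: a) auto

definition mreach where
  "mreach P s s' \<longleftrightarrow> (\<exists>j. (mnext P ^^ j) s = s')"

lemma mreach_refl: "mreach P s s"
  unfolding mreach_def by (intro exI[of _ 0]) simp

lemma mreach_step: "mreach P (mnext P s) s' \<Longrightarrow> mreach P s s'"
  unfolding mreach_def by (metis comp_apply funpow_Suc_right)

lemma mreach_trans: "mreach P s s' \<Longrightarrow> mreach P s' s'' \<Longrightarrow> mreach P s s''"
  unfolding mreach_def by (metis comp_apply funpow_add)

text \<open>Jump targets are absolute, so each piece is considered at its place in the whole program
  \<open>P\<close>. The induction follows the execution, because a loop recurs to itself after every
  pass.\<close>

lemma mreach_compile:
  "exec c \<sigma> \<sigma>' \<Longrightarrow> P = xs @ compile (length xs) c @ ys \<Longrightarrow>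
    mreach P (length xs, \<sigma>) (length xs + clen c, \<sigma>')"
proof (induction arbitrary: xs ys rule: exec.induct)
  case (Skip \<sigma>)
  show ?case by (simp add: mreach_refl)
next
  case (Inc r \<sigma>)
  show ?case by (rule mreach_step) (use Inc in \<open>simp add: nth_append mreach_refl fun_upd_def\<close>)
next
  case (Seq c \<sigma> \<sigma>' d \<sigma>'')
  have "mreach P (length xs, \<sigma>) (length xs + clen c, \<sigma>')"
    using Seq.IH(1)[of xs "compile (length xs + clen c) d @ ys"] Seq.prems by simp
  moreover have "mreach P (length xs + clen c, \<sigma>') (length xs + clen c + clen d, \<sigma>'')"
    using Seq.IH(2)[of "xs @ compile (length xs) c" ys] Seq.prems by (simp add: length_compile)
  ultimately show ?case using mreach_trans by (simp add: add.assoc)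
next
  case (Loop_0 \<sigma> r c)
  show ?case by (rule mreach_step) (use Loop_0 in \<open>simp add: nth_append mreach_refl fun_upd_def\<close>)
next
  case (Loop_Suc \<sigma> r v c \<sigma>' \<sigma>'')
  let ?a = "length xs"
  have P: "P = (xs @ [JZD r (?a + clen c + 2) (?a + 1)]) @ compile (?a + 1) c @ (JMP ?a # ys)"
    using Loop_Suc.prems by simp
  have "mreach P (?a + 1, \<sigma>(r := v)) (?a + 1 + clen c, \<sigma>')"
    using Loop_Suc.IH(1)[of "xs @ [JZD r (?a + clen c + 2) (?a + 1)]" "JMP ?a # ys"] P by (simp add: fun_upd_def)
  moreover have "mnext P (?a, \<sigma>) = (?a + 1, \<sigma>(r := v))"
    using Loop_Suc.hyps(1) by (simp add: P nth_append)
  moreover have "mnext P (?a + 1 + clen c, \<sigma>') = (?a, \<sigma>')"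
    by (simp add: P nth_append length_compile)
  ultimately show ?case
    using Loop_Suc.IH(2)[OF Loop_Suc.prems] by (metis mreach_step mreach_trans)
qed

lemma mnext_halted:
  assumes "\<not> fst ((mnext P ^^ j) s) < length P"
  shows "(mnext P ^^ (j + i)) s = (mnext P ^^ j) s"
proof (induction i)
  case (Suc i)
  have "(mnext P ^^ (j + Suc i)) s = mnext P ((mnext P ^^ (j + i)) s)" by simp
  also have "\<dots> = (mnext P ^^ j) s"
    unfolding Suc.IH using assms by (cases "(mnext P ^^ j) s") auto
  finally show ?case .
qed simp

definition start_regs :: "nat \<Rightarrow> nat \<Rightarrow> nat" where
  "start_regs n = (\<lambda>r. if r = 0 then n else 0)"

text \<open>Two appended instructions turn the value into termination: on 0 the test jumps just
  behind the program, otherwise it enters a jump to itself. Inputs without a value are left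
  open.\<close>

lemma machine_exists:
  "\<exists>P. \<forall>n y. computes f [n] y \<longrightarrow>
     (if y = 0 then \<exists>k. fst ((mnext P ^^ k) (0, start_regs n)) = length P
      else \<forall>k. fst ((mnext P ^^ k) (0, start_regs n)) < length P)"
proof -
  obtain c where c: "implements f [0] 1 2 c"
    using implementableD[OF implementable, of 1 2 "[0]" f] by auto
  let ?e = "clen c"
  define P where "P = compile 0 c @ [JZD 1 (?e + 2) (?e + 1), JMP (?e + 1)]"
  have len: "length P = ?e + 2" by (simp add: P_def length_compile)
  have "if y = 0 then \<exists>k. fst ((mnext P ^^ k) (0, start_regs n)) = length P
      else \<forall>k. fst ((mnext P ^^ k) (0, start_regs n)) < length P"
    if y: "computes f [n] y" for n y
  proof -
    let ?s = "\<lambda>k. (mnext P ^^ k) (0, start_regs n)"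
    obtain \<sigma> where \<sigma>: "exec c (start_regs n) \<sigma>" "\<sigma> 1 = y"
      by (rule implementsD[OF c y, of "start_regs n"]) (auto simp: start_regs_def)
    obtain k where k: "?s k = (?e, \<sigma>)"
      using mreach_compile[OF \<sigma>(1), of P "[]"] by (auto simp: P_def mreach_def)
    have ks: "?s (Suc k) = (if y = 0 then (?e + 2, \<sigma>) else (?e + 1, \<sigma>(1 := y - 1)))"
      using k \<sigma>(2) by (simp add: P_def nth_append length_compile)
    show ?thesis
    proof (cases "y = 0")
      case True
      then have "fst (?s (Suc k)) = length P" using ks len by simp
      with True show ?thesis by metis
    next
      case False
      have late: "?s (Suc k + i) = (?e + 1, \<sigma>(1 := y - 1))" for i
      proof (induction i)
        case (Suc i)
        have "?s (Suc k + Suc i) = mnext P (?s (Suc k + i))" by simp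
        also have "\<dots> = (?e + 1, \<sigma>(1 := y - 1))"
          unfolding Suc.IH by (simp add: P_def nth_append length_compile)
        finally show ?case .
      qed (use ks False in \<open>simp add: fun_upd_def\<close>)
      have "fst (?s j) < length P" for j
      proof (rule ccontr)
        assume j: "\<not> fst (?s j) < length P"
        \<comment> \<open>A run outside the program at step \<open>j\<close> would still be outside
          at step \<open>Suc k + j\<close>, where it is in fact at the endless jump.\<close>
        from mnext_halted[OF this, of "Suc k"] late[of j] j show False by (simp add: len add.commute)
      qed
      with False show ?thesis by simp
    qed
  qed
  then show ?thesis by blast
qed

section \<open>The protocol of a counter machine and its invariant\<close>

datatype msg = Start | Overflow | Nop | IncM nat | DecM nat | IsZero nat | NonZero nat

instance msg :: countable by countable_datatype

text \<open>A counter process waits for an instruction in \<open>Wt r\<close> and runs for \<open>p + d\<close> time units in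
  \<open>Arm r d\<close> and \<open>Buf r d\<close> before its final reset. The controller is at a program position in
  \<open>Ctl i\<close>, broadcasts the instruction \<open>m\<close> with successor position \<open>b\<close> in \<open>Snd m b\<close>, and spends the
  time \<open>p\<close> in \<open>Lng b\<close> and \<open>1\<close> in \<open>Lst b\<close>. An overflow of the step counter leads to \<open>Full\<close>, and an
  input \<open>n \<ge> p\<close> to \<open>Early\<close>; both lead on to \<open>Over\<close>.\<close>

datatype st = Init | Pre | Early | Over | Done | Full | Wt nat | Arm nat nat | Buf nat nat
  | Ctl nat | Snd msg nat | Lng nat | Lst nat

instance st :: countable by countable_datatype

type_synonym sedge = "st \<times> (cmp \<times> nat bound) list \<times> msg act \<times> bool \<times> st"

text \<open>A clock showing \<open>x\<close> at an instruction is reset \<open>p - x\<close> later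
  and, with lag \<open>d\<close>, finally at \<open>p - x + d\<close>. At the next instruction,
  \<open>p + 1\<close> after the present one, it shows \<open>x + 1 - d\<close>. Counter 0 always
  has lag 0 and so counts steps.\<close>

definition lag :: "msg \<Rightarrow> nat \<Rightarrow> nat" where
  "lag m r = (if r = 0 \<or> m = IncM r then 0 else if m = DecM r then 2 else 1)"

definition ops :: "nat \<Rightarrow> msg set" where
  "ops K = insert Nop (IncM ` {..K} \<union> DecM ` {..K})"

text \<open>The triples consist of the action leaving \<open>Ctl\<close>, the instruction to
  broadcast, and the successor position. The controller cannot read counters, so it leaves a zero
  test by receiving an answer from the counter process.\<close>

fun branches :: "instr \<Rightarrow> (msg act \<times> msg \<times> nat) set" where
  "branches (INC r b) = {(Eps, IncM (Suc r), b)}"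
| "branches (JMP b) = {(Eps, Nop, b)}"
| "branches (JZD r a b) =
     {(Recv (IsZero (Suc r)), Nop, a), (Recv (NonZero (Suc r)), DecM (Suc r), b)}"

text \<open>Counters 0 and 1, the step counter and the input register, start at time 0 and hence
  show \<open>n\<close> at time \<open>n\<close>, when the controller and the other counters
  start.\<close>

definition setup_edges :: "nat \<Rightarrow> sedge set" where
  "setup_edges K =
     {(Init, [(Eq, Const 0)], Eps, False, Wt 0), (Init, [(Eq, Const 0)], Eps, False, Wt 1),
      (Init, [(Eq, Param 0)], Eps, False, Early), (Early, [], Recv Start, False, Over),
      (Pre, [(Eq, Const 0)], Bcast Start, False, Pre), (Pre, [(Eq, Const 0)], Eps, False, Ctl 0),
      (Wt 0, [(Eq, Param 0)], Eps, True, Full), (Full, [(Lt, Const 1)], Bcast Overflow, False, Full)}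
     \<union> (\<lambda>r. (Pre, [(Eq, Const 0)], Eps, False, Wt r)) ` {2..K}"

definition counter_edges :: "nat \<Rightarrow> nat \<Rightarrow> sedge set" where
  "counter_edges K r =
     {(Wt r, [(Eq, Const 0)], Bcast (IsZero r), False, Wt r),
      (Wt r, [(Gt, Const 0), (Lt, Param 0)], Bcast (NonZero r), False, Wt r),
      (Arm r 0, [(Eq, Param 0)], Eps, True, Wt r)}
     \<union> (\<Union>d\<in>{1, 2}. {(Arm r d, [(Eq, Param 0)], Eps, True, Buf r d),
          (Buf r d, [(Eq, Const (of_nat d))], Eps, True, Wt r)})
     \<union> (\<lambda>m. (Wt r, [(Lt, Param 0)], Recv m, False, Arm r (lag m r))) ` ops K"

definition control_edges :: "nat \<Rightarrow> instr \<Rightarrow> sedge set" where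
  "control_edges i I =
     {(Ctl i, [(Eq, Const 0)], Recv Overflow, False, Over)}
     \<union> (\<Union>(a, m, b)\<in>branches I.
          {(Ctl i, [(Eq, Const 0)], a, False, Snd m b),
           (Snd m b, [(Eq, Const 0)], Bcast m, False, Lng b),
           (Lng b, [(Eq, Param 0)], Eps, True, Lst b),
           (Lst b, [(Eq, Const 1)], Eps, True, Ctl b)})"

definition fixed_edges :: "instr list \<Rightarrow> nat \<Rightarrow> sedge set" where
  "fixed_edges P K =
     setup_edges K \<union> (\<Union>r\<le>K. counter_edges K r) \<union> (\<Union>i<length P. control_edges i (P ! i))
     \<union> {(Ctl (length P), [], Eps, False, Done)}"

definition input_edge :: "nat \<Rightarrow> sedge" where
  "input_edge n = (Init, [(Eq, Const (of_nat n))], Eps, True, Pre)"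

definition concrete :: "sedge \<Rightarrow> (nat, nat, nat, nat) edge" where
  "concrete = (\<lambda>(s, g, a, u, s'). (to_nat s, map (\<lambda>(c, b). (0, c, b)) g, map_act to_nat a,
     if u then {0} else {}, to_nat s'))"

definition fixed_code :: "instr list \<Rightarrow> nat \<Rightarrow> nat" where
  "fixed_code P K = set_encode (edge_code ` concrete ` fixed_edges P K)"

text \<open>\<open>fixed_code P K\<close> bounds all names in the edges, so the initial segment up
  to it can serve as state set and as alphabet. The code of the instance then depends on this number
  and \<open>n\<close> alone.\<close>

definition proto :: "instr list \<Rightarrow> nat \<Rightarrow> nat \<Rightarrow> nptbp" where
  "proto P K n = \<lparr>states = {..fixed_code P K}, clocks = {0}, alphabet = {..fixed_code P K},
     params = {0}, init = to_nat Init,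
     edges = concrete ` insert (input_edge n) (fixed_edges P K)\<rparr>"

section \<open>Edges of the numbered protocol in terms of states and messages\<close>

definition guard_sat :: "(nat \<Rightarrow> rat) \<Rightarrow> real \<Rightarrow> (cmp \<times> nat bound) list \<Rightarrow> bool" where
  "guard_sat \<pi> x g \<longleftrightarrow> (\<forall>(c, b)\<in>set g. cmp_holds c x (of_rat (bound_val \<pi> b)))"

lemma guard_sat_simps [simp]:
  "guard_sat \<pi> x []"
  "guard_sat \<pi> x ((c, b) # g) \<longleftrightarrow> cmp_holds c x (of_rat (bound_val \<pi> b)) \<and> guard_sat \<pi> x g"
  by (auto simp: guard_sat_def)

lemma takes_edge_proto:
  "takes_edge (proto P K n) \<pi> a l l' \<longleftrightarrow>
     (\<exists>s g \<alpha> u s'. (s, g, \<alpha>, u, s') \<in> insert (input_edge n) (fixed_edges P K) \<and>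
       fst l = to_nat s \<and> a = map_act to_nat \<alpha> \<and> guard_sat \<pi> (snd l 0) g \<and>
       fst l' = to_nat s' \<and> snd l' = (\<lambda>x. if u \<and> x = 0 then 0 else snd l x))"
  (is "_ \<longleftrightarrow> ?R")
proof
  assume "takes_edge (proto P K n) \<pi> a l l'"
  then obtain g U where e: "(fst l, g, a, U, fst l') \<in> concrete ` insert (input_edge n) (fixed_edges P K)"
    and g: "sat \<pi> (snd l) g" and l': "snd l' = (\<lambda>x. if x \<in> U then 0 else snd l x)"
    by (auto simp: takes_edge_def proto_def)
  from e obtain z where z: "z \<in> insert (input_edge n) (fixed_edges P K)"
    "(fst l, g, a, U, fst l') = concrete z" by (elim imageE)
  obtain s h \<alpha> u s' where zs: "z = (s, h, \<alpha>, u, s')" by (metis prod_cases5)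
  have 1: "(s, h, \<alpha>, u, s') \<in> insert (input_edge n) (fixed_edges P K)" using z(1) zs by simp
  have 2: "fst l = to_nat s" "g = map (\<lambda>(c, b). (0, c, b)) h" "a = map_act to_nat \<alpha>"
    "U = (if u then {0} else {})" "fst l' = to_nat s'"
    using z(2) by (simp_all add: concrete_def zs)
  have "guard_sat \<pi> (snd l 0) h" using g by (auto simp: 2(2) sat_def guard_sat_def)
  moreover have "snd l' = (\<lambda>x. if u \<and> x = 0 then 0 else snd l x)"
    unfolding l' 2(4) by auto
  ultimately show ?R using 1 2 by blast
next
  assume ?R
  then obtain s h \<alpha> u s' where 1: "(s, h, \<alpha>, u, s') \<in> insert (input_edge n) (fixed_edges P K)"
    and 2: "fst l = to_nat s" "a = map_act to_nat \<alpha>" "fst l' = to_nat s'"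
    and 3: "guard_sat \<pi> (snd l 0) h" "snd l' = (\<lambda>x. if u \<and> x = 0 then 0 else snd l x)"
    by blast
  have "concrete (s, h, \<alpha>, u, s') \<in> edges (proto P K n)"
    using 1 by (simp only: proto_def ptbp.simps) blast
  moreover have "sat \<pi> (snd l) (map (\<lambda>(c, b). (0, c, b)) h)"
    using 3(1) by (auto simp: sat_def guard_sat_def)
  ultimately show "takes_edge (proto P K n) \<pi> a l l'"
    unfolding takes_edge_def by (intro exI conjI) (auto simp: concrete_def 2 3(2))
qed

locale simulation =
  fixes P :: "instr list" and K n :: nat and \<pi> :: "nat \<Rightarrow> rat"
  assumes period_nonneg: "\<pi> 0 \<ge> 0"
begin

abbreviation p :: real where "p \<equiv> of_rat (\<pi> 0)"

definition mconf :: "nat \<Rightarrow> nat \<times> (nat \<Rightarrow> nat)" where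
  "mconf k = (mnext P ^^ k) (0, start_regs n)"

definition pc :: "nat \<Rightarrow> nat" where
  "pc k = fst (mconf k)"

text \<open>Counter \<open>0\<close> is a step counter; counter \<open>Suc r\<close> is register \<open>r\<close>.\<close>

definition val :: "nat \<Rightarrow> nat \<Rightarrow> nat" where
  "val k r = (case r of 0 \<Rightarrow> n + k | Suc r \<Rightarrow> snd (mconf k) r)"

text \<open>Separates genuine instructions from the stuttering of a halted machine, whose overflow
  must not count.\<close>

definition active :: "nat \<Rightarrow> bool" where
  "active k \<longleftrightarrow> (\<forall>j<k. pc j < length P)"

definition T :: "nat \<Rightarrow> real" where
  "T k = real n + real k * (p + 1)"

text \<open>The effect that \<open>m\<close> has on clocks through \<open>lag\<close> agrees with
  the effect of instruction \<open>k\<close> on all counters at once.\<close>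

definition changes :: "nat \<Rightarrow> msg \<Rightarrow> bool" where
  "changes k m \<longleftrightarrow> (\<forall>r. val (Suc k) r + lag m r = val k r + 1)"

text \<open>Truthfulness of a message. Tests and overflow reports can be sent at any time, but a
  controller listens only at some \<open>T k\<close>, so they are constrained only there.
  Instructions must be sent at such a time.\<close>

definition msg_ok :: "real \<Rightarrow> msg \<Rightarrow> bool" where
  "msg_ok t m = (case m of
      Start \<Rightarrow> t = real n
    | Overflow \<Rightarrow> (\<forall>k. t = T k \<longrightarrow> p \<le> real (val k 0))
    | IsZero r \<Rightarrow> (\<forall>k. t = T k \<longrightarrow> val k r = 0)
    | NonZero r \<Rightarrow> (\<forall>k. t = T k \<longrightarrow> val k r > 0)
    | _ \<Rightarrow> (\<exists>k. t = T k \<and> changes k m))"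

text \<open>Most clauses tie the last reset or start, at \<open>t - x\<close>, to an instruction
  \<open>k\<close>, which may be outdated after a missed message. The bound is waived for
  \<open>k = 0\<close>, since the input may be large. In \<open>Arm\<close> and \<open>Buf\<close>
  the reset still to come is tied to \<open>k\<close>; in \<open>Full\<close>, \<open>x + p\<close>
  stands for the clock without its last reset.\<close>

fun inv :: "real \<Rightarrow> st \<Rightarrow> real \<Rightarrow> bool" where
  "inv t Init x \<longleftrightarrow> t = x"
| "inv t Pre x \<longleftrightarrow> t - x = real n"
| "inv t Early x \<longleftrightarrow> p \<le> t"
| "inv t Over x \<longleftrightarrow> (\<exists>k. active k \<and> p \<le> real (n + k))"
| "inv t Done x \<longleftrightarrow> (\<exists>k. pc k = length P)"
| "inv t Full x \<longleftrightarrow> (\<exists>k. t - x - p = T k - val k 0 \<and> (k = 0 \<or> val k 0 < p + 1))"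
| "inv t (Wt r) x \<longleftrightarrow> (\<exists>k. t - x = T k - val k r \<and> (k = 0 \<or> val k r < p + 1))"
| "inv t (Arm r d) x \<longleftrightarrow> (\<exists>k. t - x + p + d = T k - val k r \<and> val k r < p + 1)"
| "inv t (Buf r d) x \<longleftrightarrow> (\<exists>k. t - x + d = T k - val k r \<and> val k r < p + 1)"
| "inv t (Ctl i) x \<longleftrightarrow> (\<exists>k. t - x = T k \<and> active k \<and> pc k = i)"
| "inv t (Snd m b) x \<longleftrightarrow> (\<exists>k. t - x = T k \<and> active (Suc k) \<and> pc (Suc k) = b \<and> changes k m)"
| "inv t (Lng b) x \<longleftrightarrow> (\<exists>k. t - x + p + 1 = T k \<and> active k \<and> pc k = b)"
| "inv t (Lst b) x \<longleftrightarrow> (\<exists>k. t - x + 1 = T k \<and> active k \<and> pc k = b)"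

section \<open>Preservation of the invariant by single edges\<close>

lemma p_nonneg: "p \<ge> 0"
  using period_nonneg by simp

lemma T_0 [simp]: "T 0 = n" and T_Suc: "T (Suc k) = T k + p + 1"
  by (simp_all add: T_def algebra_simps)

lemma val_0 [simp]: "val 0 r = (if r \<le> 1 then n else 0)"
  by (auto simp: val_def mconf_def start_regs_def split: nat.split)

lemma pc_0 [simp]: "pc 0 = 0"
  by (simp add: pc_def mconf_def)

lemma val_step_counter [simp]: "val k 0 = n + k"
  by (simp add: val_def)

lemma active_0 [simp]: "active 0"
  by (simp add: active_def)

lemma active_Suc: "active (Suc k) \<longleftrightarrow> active k \<and> pc k < length P"
  by (auto simp: active_def less_Suc_eq)

text \<open>The counter processes are in step with the controller because cycles last \<open>p + 1\<close>: a counter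
  process that has missed a message shows a clock value of at least \<open>p + 1\<close> at the next one.\<close>

lemma in_step:
  assumes "x = T j - T k + real c" "0 \<le> x" "x < p + 1" "k = 0 \<or> real c < p + 1"
  shows "j = k" "x = real c"
proof -
  have T: "T j - T k = (real j - real k) * (p + 1)" by (simp add: T_def algebra_simps)
  show "j = k"
  proof (rule linorder_cases[of j k])
    assume "j < k"
    then have "real j - real k \<le> - 1" by simp
    then have "(real j - real k) * (p + 1) \<le> - 1 * (p + 1)"
      using p_nonneg by (intro mult_right_mono) auto
    then have "T j - T k \<le> - (p + 1)" using T by simp
    moreover have "real c < p + 1" using assms(4) \<open>j < k\<close> by simp
    ultimately have False using assms(1,2) by linarith
    then show ?thesis ..
  next
    assume "k < j"
    then have "1 \<le> real j - real k" by simp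
    then have "1 * (p + 1) \<le> (real j - real k) * (p + 1)"
      using p_nonneg by (intro mult_right_mono) auto
    then have "p + 1 \<le> T j - T k" using T by simp
    then have False using assms(1,3) by linarith
    then show ?thesis ..
  qed
  with assms(1) show "x = real c" by simp
qed

text \<open>A truthful answer to a zero test rules out the wrong branch, so the branch taken has the
  effect of the instruction.\<close>

lemma changes_branch:
  assumes "pc k < length P" "(a, m, b) \<in> branches (P ! pc k)"
    and "\<And>r. a = Recv (IsZero r) \<Longrightarrow> val k r = 0" "\<And>r. a = Recv (NonZero r) \<Longrightarrow> val k r > 0"
  shows "pc (Suc k) = b" "changes k m"
proof -
  obtain \<sigma> where m: "mconf k = (pc k, \<sigma>)" by (metis pc_def prod.collapse)
  have S: "mconf (Suc k) = mnext P (pc k, \<sigma>)" unfolding m[symmetric] by (simp add: mconf_def)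
  show "pc (Suc k) = b"
    using assms m by (cases "P ! pc k") (auto simp: pc_def[of "Suc k"] S val_def)
  show "changes k m"
    unfolding changes_def
  proof
    fix r show "val (Suc k) r + lag m r = val k r + 1"
      using assms m by (cases "P ! pc k"; cases r) (auto simp: S val_def lag_def)
  qed
qed

text \<open>Invariant and truthfulness go together: a receiver relies on the message, and the sender
  guarantees it by its own invariant. The lemmas on counter and control edges have the same
  form.\<close>

lemma inv_setup:
  assumes "(s, g, a, u, s') \<in> setup_edges K" "guard_sat \<pi> x g" "x \<ge> 0" "inv t s x"
    and "\<And>m. a = Recv m \<Longrightarrow> msg_ok t m"
  shows "inv t s' (if u then 0 else x)" "\<And>m. a = Bcast m \<Longrightarrow> msg_ok t m"
proof -
  \<comment> \<open>Without the reset on entering \<open>Full\<close> the clock would show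
    \<open>x + p\<close>. The guard \<open>x < 1\<close> keeps this below \<open>p + 1\<close>, so
    that \<open>in_step\<close> applies.\<close>
  have full: "msg_ok t Overflow" if full: "inv t Full x" "x < 1"
  proof -
    obtain k where k: "t - x - p = T k - val k 0" "k = 0 \<or> val k 0 < p + 1"
      using full by auto
    have "p \<le> val j 0" if "t = T j" for j
      using in_step[of "x + p" j k "val k 0"] k \<open>x < 1\<close> \<open>x \<ge> 0\<close> p_nonneg that
      by simp
    then show ?thesis by (simp add: msg_ok_def)
  qed
  \<comment> \<open>\<open>Start\<close> is truthful only at time \<open>n\<close>, and
    \<open>Early\<close> requires \<open>p \<le> t\<close>; hence instruction 0 already
    overflows.\<close>
  have over: "inv t Over x" if "inv t Early x" "msg_ok t Start"
    using that by (auto simp: msg_ok_def intro!: exI[of _ 0])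
  have wt: "inv t (Wt r) x" if "t - x = real n - val 0 r" for r
    unfolding inv.simps by (rule exI[of _ 0]) (use that in simp)
  have ctl: "inv t (Ctl 0) x" if "t - x = n"
    unfolding inv.simps by (rule exI[of _ 0]) (use that in simp)
  have wtfull: "inv t Full 0" if "inv t (Wt 0) x" "x = p"
    using that by simp
  show "inv t s' (if u then 0 else x)"
    using assms wt over ctl wtfull unfolding setup_edges_def by (auto simp del: inv.simps(4,6,7,10))
  show "msg_ok t m" if "a = Bcast m" for m
    using assms full that unfolding setup_edges_def by (auto simp: msg_ok_def simp del: inv.simps(6))
qed

lemma inv_counter:
  assumes "(s, g, a, u, s') \<in> counter_edges K r" "guard_sat \<pi> x g" "x \<ge> 0" "inv t s x"
    and "\<And>m. a = Recv m \<Longrightarrow> msg_ok t m"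
  shows "inv t s' (if u then 0 else x)" "\<And>m. a = Bcast m \<Longrightarrow> msg_ok t m"
proof -
  have step: "j = k \<and> x = val k r"
    if "t - x = T k - val k r" "k = 0 \<or> val k r < p + 1" "t = T j" "x < p + 1" for j k
    using in_step[of x j k "val k r"] that \<open>x \<ge> 0\<close> by simp
  \<comment> \<open>By the guard \<open>x < p\<close> the process is in step, so \<open>x\<close> is
    the current value. The next value is at most \<open>x + 1\<close>, which gives the bound for
    instruction \<open>Suc j\<close>.\<close>
  have arm: "inv t (Arm r (lag m r)) x" if wt: "inv t (Wt r) x" "x < p" "msg_ok t m" "m \<in> ops K" for m
  proof -
    obtain j where j: "t = T j" "changes j m"
      using wt(3,4) by (auto simp: msg_ok_def ops_def)
    then have x: "x = val j r" using step wt by auto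
    have "real (val (Suc j) r) + real (lag m r) = real (val j r) + 1"
      using j(2) unfolding changes_def by (metis of_nat_1 of_nat_add)
    then show ?thesis using x wt(2) j(1) by (auto simp: T_Suc intro!: exI[of _ "Suc j"])
  qed
  have val: "x = val j r" if wt: "inv t (Wt r) x" "x < p + 1" and "t = T j" for j
  proof -
    obtain k where "t - x = T k - val k r" "k = 0 \<or> val k r < p + 1" using wt by auto
    with step[OF this \<open>t = T j\<close> wt(2)] show ?thesis by simp
  qed
  have zero: "msg_ok t (IsZero r)" if "inv t (Wt r) x" "x = 0"
    using val[OF that(1)] that(2) p_nonneg by (simp add: msg_ok_def)
  have nonzero: "msg_ok t (NonZero r)" if "inv t (Wt r) x" "0 < x" "x < p"
    using val[OF that(1)] that(2,3) by (fastforce simp: msg_ok_def)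
  have buf: "inv t (Wt r) 0" if "inv t (Buf r d) x" "x = d" for d
    using that by auto
  have arm0: "inv t (Wt r) 0" if "inv t (Arm r 0) x" "x = p"
    using that by auto
  have armd: "inv t (Buf r d) 0" if "inv t (Arm r d) x" "x = p" for d
    using that by auto
  show "inv t s' (if u then 0 else x)"
    using assms arm buf[of 1] buf[of 2] arm0 armd unfolding counter_edges_def
    by (auto simp del: inv.simps)
  show "msg_ok t m" if "a = Bcast m" for m
    using assms zero nonzero that unfolding counter_edges_def by (auto simp del: inv.simps)
qed

lemma inv_control:
  assumes "(s, g, a, u, s') \<in> control_edges i (P ! i)" "i < length P"
    "guard_sat \<pi> x g" "x \<ge> 0" "inv t s x"
    and msg: "\<And>m. a = Recv m \<Longrightarrow> msg_ok t m"
  shows "inv t s' (if u then 0 else x)" "\<And>m. a = Bcast m \<Longrightarrow> msg_ok t m"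
proof -
  \<comment> \<open>The guard \<open>x = 0\<close> puts the controller exactly at an instruction
    time, where \<open>msg_ok\<close> constrains the answer received.\<close>
  have snd: "inv t (Snd m b) x" if ctl: "inv t (Ctl i) x" "x = 0" "(a, m, b) \<in> branches (P ! i)" for m b
  proof -
    obtain k where k: "t = T k" "active k" "pc k = i" using ctl by auto
    have "val k r = 0" if "a = Recv (IsZero r)" for r
      using msg[OF that] k(1) by (simp add: msg_ok_def)
    moreover have "val k r > 0" if "a = Recv (NonZero r)" for r
      using msg[OF that] k(1) by (simp add: msg_ok_def)
    ultimately have "pc (Suc k) = b" "changes k m"
      using changes_branch[of k a m b] ctl(3) k(3) assms(2) by blast+
    with k assms(2) ctl(2) show ?thesis by (auto simp: active_Suc)
  qed
  have over: "inv t Over x" if "inv t (Ctl i) x" "x = 0" "msg_ok t Overflow"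
    using that by (auto simp: msg_ok_def)
  have lng: "inv t (Lng b) x" "msg_ok t m"
    if snd: "inv t (Snd m b) x" "x = 0" "(a, m, b) \<in> branches (P ! i)" for a m b
  proof -
    obtain k where "t = T k" "active (Suc k)" "pc (Suc k) = b" using snd by auto
    then show "inv t (Lng b) x" using snd(2) by (auto simp: T_Suc intro!: exI[of _ "Suc k"])
    \<comment> \<open>All messages in \<open>branches\<close> are instructions, so
      \<open>changes\<close> at this time is what truthfulness asks.\<close>
    show "msg_ok t m" using snd by (cases "P ! i") (auto simp: msg_ok_def)
  qed
  have lst: "inv t (Lst b) 0" if "inv t (Lng b) x" "x = p" for b
    using that by auto
  have ctl: "inv t (Ctl b) 0" if "inv t (Lst b) x" "x = 1" for b
    using that by auto
  show "inv t s' (if u then 0 else x)"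
    using assms snd over lng(1) lst ctl unfolding control_edges_def
    by (auto simp del: inv.simps)
  show "msg_ok t m" if "a = Bcast m" for m
    using assms lng(2) that unfolding control_edges_def
    by (auto simp del: inv.simps) (cases "P ! i"; auto)+
qed

lemma inv_edge:
  assumes "(s, g, a, u, s') \<in> insert (input_edge n) (fixed_edges P K)"
    "guard_sat \<pi> x g" "x \<ge> 0" "inv t s x" "\<And>m. a = Recv m \<Longrightarrow> msg_ok t m"
  shows "inv t s' (if u then 0 else x)" "\<And>m. a = Bcast m \<Longrightarrow> msg_ok t m"
proof -
  consider "(s, g, a, u, s') = input_edge n" | "(s, g, a, u, s') \<in> setup_edges K"
    | r where "(s, g, a, u, s') \<in> counter_edges K r"
    | i where "(s, g, a, u, s') \<in> control_edges i (P ! i)" "i < length P"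
    | "(s, g, a, u, s') = (Ctl (length P), [], Eps, False, Done)"
    using assms(1) unfolding fixed_edges_def by blast
  then have "inv t s' (if u then 0 else x) \<and> (\<forall>m. a = Bcast m \<longrightarrow> msg_ok t m)"
  proof cases
    case 1
    then show ?thesis using assms by (auto simp: input_edge_def)
  next
    case 2
    from inv_setup[OF this assms(2-5)] show ?thesis by blast
  next
    case 3
    from inv_counter[OF this assms(2-5)] show ?thesis by blast
  next
    case 4
    from inv_control[OF this assms(2-5)] show ?thesis by blast
  next
    case 5
    then show ?thesis using assms by auto
  qed
  then show "inv t s' (if u then 0 else x)" "\<And>m. a = Bcast m \<Longrightarrow> msg_ok t m" by blast+
qed

section \<open>The invariant on reachable configurations\<close>

definition linv :: "real \<Rightarrow> (nat, nat) local \<Rightarrow> bool" where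
  "linv t l \<longleftrightarrow> (\<exists>s. fst l = to_nat s \<and> inv t s (snd l 0) \<and> snd l 0 \<ge> 0)"

text \<open>A delay preserves \<open>t - x\<close>; the remaining clauses bound \<open>t\<close>
  from below or do not depend on time.\<close>

lemma inv_delay: "inv t s x \<Longrightarrow> d \<ge> 0 \<Longrightarrow> inv (t + d) s (x + d)"
  by (cases s) auto

lemma linv_takes_edge:
  assumes "takes_edge (proto P K n) \<pi> a l l'" "linv t l"
    and "\<And>m. a = Recv (to_nat m) \<Longrightarrow> msg_ok t m"
  shows "linv t l'" "\<And>b. a = Bcast b \<Longrightarrow> \<exists>m. b = to_nat m \<and> msg_ok t m"
proof -
  obtain s g \<alpha> u s' where e: "(s, g, \<alpha>, u, s') \<in> insert (input_edge n) (fixed_edges P K)"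
    "fst l = to_nat s" "a = map_act to_nat \<alpha>" "guard_sat \<pi> (snd l 0) g"
    "fst l' = to_nat s'" "snd l' = (\<lambda>x. if u \<and> x = 0 then 0 else snd l x)"
    using assms(1) unfolding takes_edge_proto by blast
  have i: "inv t s (snd l 0)" "snd l 0 \<ge> 0" using assms(2) e(2) by (auto simp: linv_def)
  have r: "msg_ok t m" if "\<alpha> = Recv m" for m using assms(3) e(3) that by simp
  note * = inv_edge[OF e(1,4) i(2,1) r]
  show "linv t l'" using *(1) i(2) e(5,6) by (auto simp: linv_def)
  show "\<exists>m. b = to_nat m \<and> msg_ok t m" if "a = Bcast b" for b
    using that e(3) *(2) by (cases \<alpha>) auto
qed

lemma linv_step:
  assumes "step (proto P K n) \<pi> C C'" "\<And>l. l \<in> set C \<Longrightarrow> linv t l"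
  shows "\<exists>t'. \<forall>l\<in>set C'. linv t' l"
  using assms(1)
proof cases
  case (internal d D i)
  have D: "linv (t + d) (D ! j)" "length D = length C" if "j < length C" for j
  proof -
    have "linv t (C ! j)" using assms(2) that by simp
    then show "linv (t + d) (D ! j)" "length D = length C"
      using that internal(1,2) inv_delay[of t _ _ d]
      by (auto simp: delay_def linv_def split: prod.split)
  qed
  have "linv (t + d) (C' ! j)" if "j < length C" for j
  proof (cases "j = i")
    case True
    show ?thesis using linv_takes_edge(1)[OF internal(5) D(1)[OF internal(4)]] True by simp
  qed (use D that internal in auto)
  then show ?thesis using internal(3) by (metis in_set_conv_nth)
next
  case (broadcast d D i R m)
  have D: "linv (t + d) (D ! j)" "length D = length C" if "j < length C" for j
  proof -
    have "linv t (C ! j)" using assms(2) that by simp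
    then show "linv (t + d) (D ! j)" "length D = length C"
      using that broadcast(1,2) inv_delay[of t _ _ d]
      by (auto simp: delay_def linv_def split: prod.split)
  qed
  \<comment> \<open>The invariant of the sender makes the message truthful at this very instant,
    which is what the receivers need.\<close>
  obtain \<mu> where \<mu>: "m = to_nat \<mu>" "msg_ok (t + d) \<mu>"
    using linv_takes_edge(2)[OF broadcast(6) D(1)[OF broadcast(4)]] by auto
  have "linv (t + d) (C' ! j)" if "j < length C" for j
  proof (cases "j = i")
    case True
    show ?thesis using linv_takes_edge(1)[OF broadcast(6) D(1)[OF broadcast(4)]] True by simp
  next
    case False
    with broadcast(7) that consider "C' ! j = D ! j"
      | "takes_edge (proto P K n) \<pi> (Recv m) (D ! j) (C' ! j)" by metis
    then show ?thesis
      using linv_takes_edge(1)[of "Recv m" "D ! j" "C' ! j" "t + d"] D[OF that] \<mu> by cases auto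
  qed
  then show ?thesis using broadcast(3) by (metis in_set_conv_nth)
qed

lemma linv_reachable:
  assumes "(step (proto P K n) \<pi>)\<^sup>*\<^sup>* (init_config (proto P K n) N) C"
  shows "\<exists>t. \<forall>l\<in>set C. linv t l"
  using assms
proof (induction rule: rtranclp_induct)
  case base
  have "linv 0 l" if "l \<in> set (init_config (proto P K n) N)" for l
    using that by (auto simp: init_config_def proto_def linv_def intro!: exI[of _ Init])
  then show ?case by blast
next
  case (step C C')
  then show ?case using linv_step by blast
qed

end

section \<open>Reachability and solo runs\<close>

text \<open>Every finite run extends to a maximal execution: to a dead end if one is reachable, and
  otherwise forever by choosing successors.\<close>

lemma reaches_iff:
  "(\<exists>\<rho>\<in>executions \<N> N \<pi>. reaches \<rho> q) \<longleftrightarrow>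
     (\<exists>C. (step \<N> \<pi>)\<^sup>*\<^sup>* (init_config \<N> N) C \<and> q \<in> fst ` set C)"
proof
  assume "\<exists>\<rho>\<in>executions \<N> N \<pi>. reaches \<rho> q"
  then obtain \<rho> C where \<rho>: "max_exec \<N> N \<pi> \<rho>" "C \<in> configs \<rho>" "q \<in> fst ` set C"
    unfolding executions_def reaches_def by blast
  have "(step \<N> \<pi>)\<^sup>*\<^sup>* (init_config \<N> N) C"
  proof (cases \<rho>)
    case (Fin Cs)
    have "k < length Cs \<Longrightarrow> (step \<N> \<pi>)\<^sup>*\<^sup>* (init_config \<N> N) (Cs ! k)" for k
    proof (induction k)
      case 0
      then show ?case using \<rho>(1) Fin by (cases Cs) auto
    next
      case (Suc k)
      then show ?case using \<rho>(1) Fin by (auto intro: rtranclp.rtrancl_into_rtrancl)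
    qed
    then show ?thesis using \<rho>(2) Fin by (auto simp: in_set_conv_nth)
  next
    case (Inf Cs)
    have "(step \<N> \<pi>)\<^sup>*\<^sup>* (init_config \<N> N) (Cs k)" for k
    proof (induction k)
      case 0
      then show ?case using \<rho>(1) Inf by auto
    next
      case (Suc k)
      then show ?case using \<rho>(1) Inf by (auto intro: rtranclp.rtrancl_into_rtrancl)
    qed
    then show ?thesis using \<rho>(2) Inf by auto
  qed
  then show "\<exists>C. (step \<N> \<pi>)\<^sup>*\<^sup>* (init_config \<N> N) C \<and> q \<in> fst ` set C"
    using \<rho>(3) by blast
next
  assume "\<exists>C. (step \<N> \<pi>)\<^sup>*\<^sup>* (init_config \<N> N) C \<and> q \<in> fst ` set C"
  then obtain C where C: "(step \<N> \<pi>)\<^sup>*\<^sup>* (init_config \<N> N) C" "q \<in> fst ` set C" by blast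
  from C(1) obtain a where "((step \<N> \<pi>) ^^ a) (init_config \<N> N) C"
    by (auto simp: rtranclp_power)
  then obtain f where f: "f 0 = init_config \<N> N" "f a = C" "\<forall>i<a. step \<N> \<pi> (f i) (f (Suc i))"
    by (auto simp: relpowp_fun_conv)
  have "\<exists>\<rho>\<in>executions \<N> N \<pi>. C \<in> configs \<rho>"
  proof (cases "\<exists>D. (step \<N> \<pi>)\<^sup>*\<^sup>* C D \<and> \<not> (\<exists>E. step \<N> \<pi> D E)")
    case True
    then obtain D b where D: "((step \<N> \<pi>) ^^ b) C D" "\<not> (\<exists>E. step \<N> \<pi> D E)"
      by (auto simp: rtranclp_power)
    then obtain g where g: "g 0 = C" "g b = D" "\<forall>i<b. step \<N> \<pi> (g i) (g (Suc i))"
      by (auto simp: relpowp_fun_conv)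
    define h where "h i = (if i < a then f i else g (i - a))" for i
    have h: "h 0 = init_config \<N> N" "h a = C" "h (a + b) = D"
      using f g by (auto simp: h_def)
    have hs: "step \<N> \<pi> (h i) (h (Suc i))" if "i < a + b" for i
    proof (cases "Suc i < a")
      case False
      show ?thesis
      proof (cases "Suc i = a")
        case True
        then show ?thesis using f g(1) by (auto simp: h_def)
      next
        case False
        then have "step \<N> \<pi> (g (i - a)) (g (Suc (i - a)))"
          using that g(3) \<open>\<not> Suc i < a\<close> by auto
        then show ?thesis using False \<open>\<not> Suc i < a\<close> by (simp add: h_def Suc_diff_le)
      qed
    qed (use f(3) in \<open>auto simp: h_def\<close>)
    let ?Cs = "map h [0..<Suc (a + b)]"
    have "max_exec \<N> N \<pi> (Fin ?Cs)"
      using h hs D(2) by (auto simp: hd_map last_map nth_append simp del: upt_Suc)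
    moreover have "C \<in> set ?Cs"
      unfolding set_map using h(2) by (intro image_eqI[of _ _ a]) auto
    ultimately show ?thesis unfolding executions_def
      by (intro bexI[of _ "Fin ?Cs"]) (auto simp del: max_exec.simps)
  next
    case False
    then have next_ex: "\<exists>E. step \<N> \<pi> D E" if "(step \<N> \<pi>)\<^sup>*\<^sup>* C D" for D
      using that by blast
    define g where "g = rec_nat C (\<lambda>_ D. SOME E. step \<N> \<pi> D E)"
    have g: "g 0 = C" "\<And>i. g (Suc i) = (SOME E. step \<N> \<pi> (g i) E)"
      by (simp_all add: g_def)
    have "(step \<N> \<pi>)\<^sup>*\<^sup>* C (g i) \<and> step \<N> \<pi> (g i) (g (Suc i))" for i
    proof (induction i)
      case 0
      show ?case using someI_ex[OF next_ex[of C]] by (simp add: g)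
    next
      case (Suc i)
      then have "(step \<N> \<pi>)\<^sup>*\<^sup>* C (g (Suc i))"
        by (auto intro: rtranclp.rtrancl_into_rtrancl)
      then show ?case using someI_ex[OF next_ex] by (simp only: g(2)[of "Suc i"])
    qed
    then have gs: "step \<N> \<pi> (g i) (g (Suc i))" for i by blast
    define h where "h i = (if i < a then f i else g (i - a))" for i
    have hs: "step \<N> \<pi> (h i) (h (Suc i))" for i
    proof (cases "Suc i < a")
      case False
      show ?thesis
      proof (cases "Suc i = a")
        case True
        then show ?thesis using f g(1) by (auto simp: h_def)
      next
        case False
        then show ?thesis using gs[of "i - a"] \<open>\<not> Suc i < a\<close> by (simp add: h_def Suc_diff_le)
      qed
    qed (use f(3) in \<open>auto simp: h_def\<close>)
    have "max_exec \<N> N \<pi> (Inf h)" using hs f g(1) by (auto simp: h_def)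
    moreover have "C = h a" using g(1) by (simp add: h_def)
    ultimately show ?thesis unfolding executions_def
      by (intro bexI[of _ "Inf h"]) (auto simp del: max_exec.simps)
  qed
  then show "\<exists>\<rho>\<in>executions \<N> N \<pi>. reaches \<rho> q"
    using C(2) unfolding reaches_def by blast
qed

fun fits :: "nat \<Rightarrow> instr \<Rightarrow> bool" where
  "fits K (INC r b) \<longleftrightarrow> Suc r \<le> K"
| "fits K (JMP b) \<longleftrightarrow> True"
| "fits K (JZD r a b) \<longleftrightarrow> Suc r \<le> K"

context simulation
begin

section \<open>Local runs and their composition\<close>

definition ledge :: "msg act \<Rightarrow> st \<times> real \<Rightarrow> st \<times> real \<Rightarrow> bool" where
  "ledge a l l' \<longleftrightarrow> (\<exists>g u. (fst l, g, a, u, fst l') \<in> insert (input_edge n) (fixed_edges P K) \<and>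
     guard_sat \<pi> (snd l) g \<and> snd l' = (if u then 0 else snd l))"

definition matches :: "(nat, nat) local \<Rightarrow> st \<times> real \<Rightarrow> bool" where
  "matches d l \<longleftrightarrow> fst d = to_nat (fst l) \<and> snd d 0 = snd l"

text \<open>Only the states and clock values are recorded, after an arbitrary final delay.\<close>

definition attainable :: "nat \<Rightarrow> (nat \<Rightarrow> st \<times> real) \<Rightarrow> bool" where
  "attainable N w \<longleftrightarrow> (\<exists>C t. (step (proto P K n) \<pi>)\<^sup>*\<^sup>* (init_config (proto P K n) N) C \<and> t \<ge> 0 \<and>
     length C = N \<and> (\<forall>i<N. matches (delay t C ! i) (w i)))"

lemma ledge_takes_edge:
  assumes "ledge a l l'" "matches d l"
  shows "\<exists>d'. takes_edge (proto P K n) \<pi> (map_act to_nat a) d d' \<and> matches d' l'"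
proof -
  from assms(1) obtain g u where e: "(fst l, g, a, u, fst l') \<in> insert (input_edge n) (fixed_edges P K)"
    "guard_sat \<pi> (snd l) g" "snd l' = (if u then 0 else snd l)"
    unfolding ledge_def by blast
  let ?d = "(to_nat (fst l'), \<lambda>x. if u \<and> x = 0 then 0 else snd d x)"
  have "takes_edge (proto P K n) \<pi> (map_act to_nat a) d ?d"
    by (rule takes_edge_proto[THEN iffD2], intro exI conjI)
      (rule e(1), use e(2) assms(2) in \<open>auto simp: matches_def\<close>)
  moreover have "matches ?d l'" using e(3) assms(2) by (auto simp: matches_def)
  ultimately show ?thesis by blast
qed

lemma attainable_cong: "attainable N w \<Longrightarrow> (\<And>i. i < N \<Longrightarrow> w' i = w i) \<Longrightarrow> attainable N w'"
  unfolding attainable_def by auto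

lemma attainable_init: "attainable N (\<lambda>_. (Init, 0))"
  unfolding attainable_def
  by (intro exI[of _ "init_config (proto P K n) N"] exI[of _ 0])
    (auto simp: init_config_def delay_def matches_def proto_def)

lemma attainable_delay:
  assumes "attainable N w" "d \<ge> 0"
  shows "attainable N (\<lambda>i. (fst (w i), snd (w i) + d))"
proof -
  obtain C t where C: "(step (proto P K n) \<pi>)\<^sup>*\<^sup>* (init_config (proto P K n) N) C" "t \<ge> 0"
    "length C = N" "\<forall>i<N. matches (delay t C ! i) (w i)"
    using assms(1) unfolding attainable_def by blast
  have "\<forall>i<N. matches (delay (t + d) C ! i) (fst (w i), snd (w i) + d)"
    using C(3,4) by (auto simp: matches_def delay_def split_beta)
  then show ?thesis using C assms(2) unfolding attainable_def by (intro exI[of _ C] exI[of _ "t + d"]) auto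
qed

lemma attainable_eps:
  assumes "attainable N w" "i < N" "ledge Eps (w i) l"
  shows "attainable N (w(i := l))"
proof -
  obtain C t where C: "(step (proto P K n) \<pi>)\<^sup>*\<^sup>* (init_config (proto P K n) N) C" "t \<ge> 0"
    "length C = N" "\<forall>i<N. matches (delay t C ! i) (w i)"
    using assms(1) unfolding attainable_def by blast
  let ?D = "delay t C"
  have len: "length ?D = N" using C(3) by (simp add: delay_def)
  obtain d where d: "takes_edge (proto P K n) \<pi> Eps (?D ! i) d" "matches d l"
    using ledge_takes_edge[OF assms(3), of "?D ! i"] C(4) assms(2) by auto
  let ?C = "?D[i := d]"
  \<comment> \<open>The pending delay \<open>t\<close> becomes the delay with which the step begins,
    so afterwards the pending delay is 0.\<close>
  have "step (proto P K n) \<pi> C ?C"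
    by (rule step.internal[of t ?D _ _ i]) (use C len d assms(2) in auto)
  with C(1) have "(step (proto P K n) \<pi>)\<^sup>*\<^sup>* (init_config (proto P K n) N) ?C" by simp
  moreover have "delay 0 ?C = ?C" by (simp add: delay_def)
  then have "\<forall>j<N. matches (delay 0 ?C ! j) ((w(i := l)) j)"
    using C(4) d(2) len by (auto simp: nth_list_update)
  ultimately show ?thesis
    unfolding attainable_def using len by (intro exI[of _ ?C] exI[of _ 0]) auto
qed

text \<open>Reconfigurability allows any receiver set: processes outside \<open>R\<close> keep their
  state even if they could receive the message.\<close>

lemma attainable_bcast:
  assumes "attainable N w" "i < N" "ledge (Bcast m) (w i) l" "R \<subseteq> {..<N}" "i \<notin> R"
    and "\<And>j. j \<in> R \<Longrightarrow> ledge (Recv m) (w j) (f j)"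
  shows "attainable N (\<lambda>j. if j = i then l else if j \<in> R then f j else w j)" (is "attainable N ?w")
proof -
  obtain C t where C: "(step (proto P K n) \<pi>)\<^sup>*\<^sup>* (init_config (proto P K n) N) C" "t \<ge> 0"
    "length C = N" "\<forall>i<N. matches (delay t C ! i) (w i)"
    using assms(1) unfolding attainable_def by blast
  let ?D = "delay t C"
  have len: "length ?D = N" using C(3) by (simp add: delay_def)
  obtain d where d: "takes_edge (proto P K n) \<pi> (Bcast (to_nat m)) (?D ! i) d" "matches d l"
    using ledge_takes_edge[OF assms(3), of "?D ! i"] C(4) assms(2) by auto
  have "\<forall>j\<in>R. \<exists>e. takes_edge (proto P K n) \<pi> (Recv (to_nat m)) (?D ! j) e \<and> matches e (f j)"
  proof
    fix j assume j: "j \<in> R"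
    then have "matches (?D ! j) (w j)" using C(4) assms(4) by auto
    from ledge_takes_edge[OF assms(6)[OF j] this]
    show "\<exists>e. takes_edge (proto P K n) \<pi> (Recv (to_nat m)) (?D ! j) e \<and> matches e (f j)" by simp
  qed
  from bchoice[OF this] obtain e where "\<forall>j\<in>R. takes_edge (proto P K n) \<pi> (Recv (to_nat m)) (?D ! j) (e j)
    \<and> matches (e j) (f j)" ..
  then have e: "\<And>j. j \<in> R \<Longrightarrow> takes_edge (proto P K n) \<pi> (Recv (to_nat m)) (?D ! j) (e j)"
    "\<And>j. j \<in> R \<Longrightarrow> matches (e j) (f j)" by blast+
  let ?C = "map (\<lambda>j. if j = i then d else if j \<in> R then e j else ?D ! j) [0..<N]"
  have "step (proto P K n) \<pi> C ?C"
  proof (rule step.broadcast[where t = t and i = i and R = R and m = "to_nat m", OF C(2) refl])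
    show "\<forall>j<length C. j \<noteq> i \<longrightarrow>
      (if j \<in> R \<and> (\<exists>l. takes_edge (proto P K n) \<pi> (Recv (to_nat m)) (?D ! j) l)
       then takes_edge (proto P K n) \<pi> (Recv (to_nat m)) (?D ! j) (?C ! j) else ?C ! j = ?D ! j)"
    proof (intro allI impI)
      fix j assume "j < length C" "j \<noteq> i"
      then have "?C ! j = (if j \<in> R then e j else ?D ! j)" using C(3) by simp
      then show "if j \<in> R \<and> (\<exists>l. takes_edge (proto P K n) \<pi> (Recv (to_nat m)) (?D ! j) l)
       then takes_edge (proto P K n) \<pi> (Recv (to_nat m)) (?D ! j) (?C ! j) else ?C ! j = ?D ! j"
        using e(1)[of j] by presburger
    qed
  qed (use C(3) d(1) assms(2,4) in simp_all)
  with C(1) have "(step (proto P K n) \<pi>)\<^sup>*\<^sup>* (init_config (proto P K n) N) ?C" by simp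
  moreover have "delay 0 ?C = ?C" by (simp add: delay_def)
  moreover have "\<forall>j<N. matches (?C ! j) (?w j)"
    using C(4) d(2) e(2) by simp
  ultimately show ?thesis
    unfolding attainable_def by (intro exI[of _ ?C] exI[of _ 0]) simp
qed

text \<open>A run of one process by internal edges, of duration \<open>\<tau>\<close>. The number
  \<open>k\<close> of edges supplies the measure for interleaving.\<close>

inductive solo :: "nat \<Rightarrow> st \<times> real \<Rightarrow> real \<Rightarrow> st \<times> real \<Rightarrow> bool" where
  solo_0: "\<tau> \<ge> 0 \<Longrightarrow> y = x + \<tau> \<Longrightarrow> solo 0 (s, x) \<tau> (s, y)"
| solo_Suc: "a \<ge> 0 \<Longrightarrow> ledge Eps (s, x + a) l \<Longrightarrow> solo k l (\<tau> - a) l' \<Longrightarrow> solo (Suc k) (s, x) \<tau> l'"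

lemma solo_nonneg: "solo k l \<tau> l' \<Longrightarrow> \<tau> \<ge> 0"
  by (induction rule: solo.induct) auto

lemma solo_pos:
  assumes "solo k l \<tau> l'" "k \<noteq> 0"
  obtains a l1 where "0 \<le> a" "ledge Eps (fst l, snd l + a) l1" "solo (k - 1) l1 (\<tau> - a) l'"
  using assms by (cases rule: solo.cases) auto

text \<open>Solo runs are interleaved by always letting the process with the earliest next event move.\<close>

lemma attainable_solo:
  assumes "attainable N w" "\<And>i. i < N \<Longrightarrow> solo (k i) (w i) \<tau> (w' i)" "\<tau> \<ge> 0"
  shows "attainable N w'"
  using assms
proof (induction "\<Sum>i<N. k i" arbitrary: w \<tau> k rule: less_induct)
  case less
  show ?case
  proof (cases "\<exists>i<N. k i \<noteq> 0")
    case False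
    have "w' i = (fst (w i), snd (w i) + \<tau>)" if "i < N" for i
      using less.prems(2)[OF that] False that by (auto elim: solo.cases)
    then show ?thesis using attainable_cong[OF attainable_delay[OF less.prems(1,3)]] by blast
  next
    case True
    let ?I = "{i. i < N \<and> k i \<noteq> 0}"
    have "\<forall>i\<in>?I. \<exists>a l. 0 \<le> a \<and> ledge Eps (fst (w i), snd (w i) + a) l \<and>
        solo (k i - 1) l (\<tau> - a) (w' i)"
    proof
      fix i assume "i \<in> ?I"
      then have "solo (k i) (w i) \<tau> (w' i)" "k i \<noteq> 0" using less.prems(2) by auto
      from solo_pos[OF this] show "\<exists>a l. 0 \<le> a \<and> ledge Eps (fst (w i), snd (w i) + a) l \<and>
        solo (k i - 1) l (\<tau> - a) (w' i)" by blast
    qed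
    from bchoice[OF this] obtain a where "\<forall>i\<in>?I. \<exists>l. 0 \<le> a i \<and>
        ledge Eps (fst (w i), snd (w i) + a i) l \<and> solo (k i - 1) l (\<tau> - a i) (w' i)" ..
    from bchoice[OF this] obtain l where l: "\<forall>i\<in>?I. 0 \<le> a i \<and>
        ledge Eps (fst (w i), snd (w i) + a i) (l i) \<and> solo (k i - 1) (l i) (\<tau> - a i) (w' i)" ..
    have al: "0 \<le> a i" "ledge Eps (fst (w i), snd (w i) + a i) (l i)"
      "solo (k i - 1) (l i) (\<tau> - a i) (w' i)" if "i \<in> ?I" for i
      using l that by blast+
    have I: "finite ?I" "?I \<noteq> {}" using True by auto
    then have "Min (a ` ?I) \<in> a ` ?I" by (intro Min_in) auto
    then obtain i where "i \<in> ?I" "Min (a ` ?I) = a i" by blast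
    moreover have "Min (a ` ?I) \<le> a j" if "j \<in> ?I" for j using I(1) that by (intro Min_le) auto
    ultimately have i: "i \<in> ?I" "\<And>j. j \<in> ?I \<Longrightarrow> a i \<le> a j" by auto
    let ?w = "(\<lambda>j. (fst (w j), snd (w j) + a i))(i := l i)"
    let ?k = "k(i := k i - 1)"
    have w: "attainable N ?w"
      using attainable_eps[OF attainable_delay[OF less.prems(1) al(1)[OF i(1)]], of i "l i"] al(2)[OF i(1)] i(1)
      by simp
    have "solo (?k j) (?w j) (\<tau> - a i) (w' j)" if "j < N" for j
    proof (cases "j = i")
      case True
      then show ?thesis using al(3)[OF i(1)] by simp
    next
      case ji: False
      show ?thesis
      proof (cases "k j = 0")
        case True
        have "w' j = (fst (w j), snd (w j) + \<tau>)"
          using less.prems(2)[OF that] True by (auto elim: solo.cases)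
        moreover have "\<tau> - a i \<ge> 0" using solo_nonneg[OF al(3)[OF i(1)]] .
        ultimately show ?thesis using True ji by (auto intro: solo_0)
      next
        case False
        then have j: "j \<in> ?I" using that by simp
        have "solo (Suc (k j - 1)) (fst (w j), snd (w j) + a i) (\<tau> - a i) (w' j)"
          by (rule solo_Suc[of "a j - a i" _ _ "l j"]) (use al(2,3)[OF j] i(2)[OF j] in auto)
        then show ?thesis using ji False by simp
      qed
    qed
    moreover have "(\<Sum>j<N. ?k j) < (\<Sum>j<N. k j)"
      using i(1) by (intro sum_strict_mono_ex1) auto
    moreover have "\<tau> - a i \<ge> 0" using solo_nonneg[OF al(3)[OF i(1)]] .
    ultimately show ?thesis using less.hyps[OF _ w] by blast
  qed
qed

lemma attainable_solo_runs:
  assumes "attainable N w" "\<And>i. i < N \<Longrightarrow> \<exists>k. solo k (w i) \<tau> (w' i)" "\<tau> \<ge> 0"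
  shows "attainable N w'"
proof -
  obtain k where "\<And>i. i < N \<Longrightarrow> solo (k i) (w i) \<tau> (w' i)" using assms(2) by metis
  then show ?thesis using attainable_solo assms by blast
qed

end

section \<open>Completeness of the simulation\<close>

context simulation
begin

text \<open>The intended configuration at time \<open>T k\<close>. Process \<open>K + 2\<close>
  idles in \<open>Init\<close>; it is the one that turns \<open>Early\<close> when
  \<open>p \<le> n\<close>. Thus one network size serves all parameter values, as universality
  demands.\<close>

definition conf :: "nat \<Rightarrow> nat \<Rightarrow> st \<times> real" where
  "conf k i = (if i \<le> K then (Wt i, val k i) else if i = K + 1 then (Ctl (pc k), 0) else (Init, T k))"

section \<open>Local edges of the protocol\<close>

lemma ledge_setup:
  assumes "(s, g, a, u, s') \<in> setup_edges K" "guard_sat \<pi> x g" "x' = (if u then 0 else x)"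
  shows "ledge a (s, x) (s', x')"
  using assms unfolding ledge_def fixed_edges_def by (intro exI[of _ g] exI[of _ u]) simp

lemma ledge_counter:
  assumes "(s, g, a, u, s') \<in> counter_edges K r" "r \<le> K" "guard_sat \<pi> x g"
    "x' = (if u then 0 else x)"
  shows "ledge a (s, x) (s', x')"
  using assms unfolding ledge_def fixed_edges_def by (intro exI[of _ g] exI[of _ u]) auto

lemma ledge_control:
  assumes "(s, g, a, u, s') \<in> control_edges i (P ! i)" "i < length P" "guard_sat \<pi> x g"
    "x' = (if u then 0 else x)"
  shows "ledge a (s, x) (s', x')"
  using assms unfolding ledge_def fixed_edges_def by (intro exI[of _ g] exI[of _ u]) auto

lemma ledge_input: "ledge Eps (Init, real n) (Pre, 0)"
  unfolding ledge_def input_edge_def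
  by (intro exI[of _ "[(Eq, Const (of_nat n))]"] exI[of _ True]) simp

lemma ledge_Init_Wt: "r \<le> 1 \<Longrightarrow> ledge Eps (Init, 0) (Wt r, 0)"
  by (rule ledge_setup[of _ "[(Eq, Const 0)]" _ False])
    (auto simp: setup_edges_def le_Suc_eq)

lemma ledge_Pre_Wt: "2 \<le> r \<Longrightarrow> r \<le> K \<Longrightarrow> ledge Eps (Pre, 0) (Wt r, 0)"
  by (rule ledge_setup[of _ "[(Eq, Const 0)]" _ False]) (auto simp: setup_edges_def)

lemma ledge_Pre_Ctl: "ledge Eps (Pre, 0) (Ctl 0, 0)"
  by (rule ledge_setup[of _ "[(Eq, Const 0)]" _ False]) (auto simp: setup_edges_def)

lemma ledge_Early: "ledge Eps (Init, p) (Early, p)"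
  by (rule ledge_setup[of _ "[(Eq, Param 0)]" _ False]) (auto simp: setup_edges_def)

lemma ledge_Start: "ledge (Bcast Start) (Pre, 0) (Pre, 0)"
  by (rule ledge_setup[of _ "[(Eq, Const 0)]" _ False]) (auto simp: setup_edges_def)

lemma ledge_Start_Over: "ledge (Recv Start) (Early, x) (Over, x)"
  by (rule ledge_setup[of _ "[]" _ False]) (auto simp: setup_edges_def)

lemma ledge_Full: "ledge Eps (Wt 0, p) (Full, 0)"
  by (rule ledge_setup[of _ "[(Eq, Param 0)]" _ True]) (auto simp: setup_edges_def)

lemma ledge_Overflow: "x < 1 \<Longrightarrow> ledge (Bcast Overflow) (Full, x) (Full, x)"
  by (rule ledge_setup[of _ "[(Lt, Const 1)]" _ False]) (auto simp: setup_edges_def)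

lemma ledge_IsZero: "r \<le> K \<Longrightarrow> ledge (Bcast (IsZero r)) (Wt r, 0) (Wt r, 0)"
  by (rule ledge_counter[of _ "[(Eq, Const 0)]" _ False]) (auto simp: counter_edges_def)

lemma ledge_NonZero:
  "r \<le> K \<Longrightarrow> 0 < x \<Longrightarrow> x < p \<Longrightarrow> ledge (Bcast (NonZero r)) (Wt r, x) (Wt r, x)"
  by (rule ledge_counter[of _ "[(Gt, Const 0), (Lt, Param 0)]" _ False]) (auto simp: counter_edges_def)

lemma ledge_arm:
  "r \<le> K \<Longrightarrow> m \<in> ops K \<Longrightarrow> x < p \<Longrightarrow> ledge (Recv m) (Wt r, x) (Arm r (lag m r), x)"
  by (rule ledge_counter[of _ "[(Lt, Param 0)]" _ False]) (auto simp: counter_edges_def)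

lemma ledge_Arm_Wt: "r \<le> K \<Longrightarrow> ledge Eps (Arm r 0, p) (Wt r, 0)"
  by (rule ledge_counter[of _ "[(Eq, Param 0)]" _ True]) (auto simp: counter_edges_def)

lemma ledge_Arm_Buf: "r \<le> K \<Longrightarrow> d \<in> {1, 2} \<Longrightarrow> ledge Eps (Arm r d, p) (Buf r d, 0)"
  by (rule ledge_counter[of _ "[(Eq, Param 0)]" _ True]) (auto simp: counter_edges_def)

lemma ledge_Buf: "r \<le> K \<Longrightarrow> d \<in> {1, 2} \<Longrightarrow> ledge Eps (Buf r d, real d) (Wt r, 0)"
  by (rule ledge_counter[of _ "[(Eq, Const (of_nat d))]" _ True]) (auto simp: counter_edges_def)

lemma ledge_Ctl_Over: "i < length P \<Longrightarrow> ledge (Recv Overflow) (Ctl i, 0) (Over, 0)"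
  by (rule ledge_control[of _ "[(Eq, Const 0)]" _ False]) (auto simp: control_edges_def)

lemma ledge_branch:
  assumes "i < length P" "(a, m, b) \<in> branches (P ! i)"
  shows "ledge a (Ctl i, 0) (Snd m b, 0)" "ledge (Bcast m) (Snd m b, 0) (Lng b, 0)"
    "ledge Eps (Lng b, p) (Lst b, 0)" "ledge Eps (Lst b, 1) (Ctl b, 0)"
proof -
  have "{(Ctl i, [(Eq, Const 0)], a, False, Snd m b),
           (Snd m b, [(Eq, Const 0)], Bcast m, False, Lng b),
           (Lng b, [(Eq, Param 0)], Eps, True, Lst b),
           (Lst b, [(Eq, Const 1)], Eps, True, Ctl b)} \<subseteq> control_edges i (P ! i)"
    unfolding control_edges_def using assms(2) by fastforce
  then have e: "(Ctl i, [(Eq, Const 0)], a, False, Snd m b) \<in> control_edges i (P ! i)"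
      "(Snd m b, [(Eq, Const 0)], Bcast m, False, Lng b) \<in> control_edges i (P ! i)"
      "(Lng b, [(Eq, Param 0)], Eps, True, Lst b) \<in> control_edges i (P ! i)"
      "(Lst b, [(Eq, Const 1)], Eps, True, Ctl b) \<in> control_edges i (P ! i)"
    by blast+
  show "ledge a (Ctl i, 0) (Snd m b, 0)" by (rule ledge_control[OF e(1) assms(1)]) simp_all
  show "ledge (Bcast m) (Snd m b, 0) (Lng b, 0)" by (rule ledge_control[OF e(2) assms(1)]) simp_all
  show "ledge Eps (Lng b, p) (Lst b, 0)" by (rule ledge_control[OF e(3) assms(1)]) simp_all
  show "ledge Eps (Lst b, 1) (Ctl b, 0)" by (rule ledge_control[OF e(4) assms(1)]) simp_all
qed

lemma ledge_Done: "ledge Eps (Ctl (length P), x) (Done, x)"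
  unfolding ledge_def fixed_edges_def by (intro exI[of _ "[]"] exI[of _ False]) simp

section \<open>Faithful runs along the computation of the machine\<close>

lemma attainable_setup:
  assumes "1 \<le> K"
  shows "attainable (K + 3) (conf 0)"
proof (rule attainable_solo_runs[OF attainable_init])
  fix i assume i: "i < K + 3"
  consider "i \<le> 1" | "2 \<le> i" "i \<le> K" | "i = K + 1" | "i = K + 2" using i by linarith
  then show "\<exists>k. solo k (Init, 0) n (conf 0 i)"
  proof cases
    case 1
    have "solo (Suc 0) (Init, 0) n (Wt i, n)"
      by (rule solo_Suc[of 0]) (use ledge_Init_Wt[OF 1] in \<open>auto intro: solo_0\<close>)
    then show ?thesis using 1 assms by (auto simp: conf_def)
  next
    case 2
    have "solo (Suc (Suc 0)) (Init, 0) n (Wt i, 0)"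
      by (rule solo_Suc[of n _ _ "(Pre, 0)"], simp, simp add: ledge_input, rule solo_Suc[of 0])
        (use ledge_Pre_Wt[OF 2] in \<open>auto intro: solo_0\<close>)
    then show ?thesis using 2 by (auto simp: conf_def)
  next
    case 3
    have "solo (Suc (Suc 0)) (Init, 0) n (Ctl 0, 0)"
      by (rule solo_Suc[of n _ _ "(Pre, 0)"], simp, simp add: ledge_input, rule solo_Suc[of 0])
        (use ledge_Pre_Ctl in \<open>auto intro: solo_0\<close>)
    then show ?thesis using 3 by (auto simp: conf_def)
  next
    case 4
    then show ?thesis by (auto simp: conf_def intro!: exI[of _ 0] solo_0)
  qed
qed simp

lemma lag_cases: "lag m r = 0 \<or> lag m r \<in> {1, 2}"
  by (auto simp: lag_def)

lemma solo_Arm: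
  fixes x y :: real
  assumes "r \<le> K" "0 \<le> x" "x < p" "y + lag m r = x + 1" "0 \<le> y"
  shows "\<exists>k. solo k (Arm r (lag m r), x) (p + 1) (Wt r, y)"
proof (cases "lag m r = 0")
  case True
  have "solo (Suc 0) (Arm r 0, x) (p + 1) (Wt r, y)"
    by (rule solo_Suc[of "p - x"])
      (use assms True ledge_Arm_Wt in \<open>auto intro!: solo_0\<close>)
  then show ?thesis using True by auto
next
  case False
  let ?d = "lag m r"
  have d: "?d \<in> {1, 2}" using lag_cases[of m r] False by simp
  have "solo (Suc 0) (Buf r ?d, 0) (x + 1) (Wt r, y)"
    by (rule solo_Suc[of ?d])
      (use assms ledge_Buf[OF assms(1) d] in \<open>auto intro!: solo_0\<close>)
  then have "solo (Suc (Suc 0)) (Arm r ?d, x) (p + 1) (Wt r, y)"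
    by (intro solo_Suc[of "p - x"])
      (use assms ledge_Arm_Buf[OF assms(1) d] in \<open>auto simp: algebra_simps\<close>)
  then show ?thesis by blast
qed

text \<open>The cycle in which the step counter reaches \<open>p\<close>: after its reset it waits
  until the clock shows \<open>p\<close> again, and less than one time unit remains in
  \<open>Full\<close>, as the guard of \<open>Overflow\<close> requires.\<close>

lemma solo_Arm_Full:
  fixes x :: real
  assumes "0 \<le> x" "x < p" "p \<le> x + 1"
  shows "\<exists>k. solo k (Arm 0 0, x) (p + 1) (Full, x + 1 - p)"
proof -
  have "solo (Suc 0) (Wt 0, 0) (x + 1) (Full, x + 1 - p)"
    by (rule solo_Suc[of p]) (use assms ledge_Full p_nonneg in \<open>auto intro!: solo_0\<close>)
  then have "solo (Suc (Suc 0)) (Arm 0 0, x) (p + 1) (Full, x + 1 - p)"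
    by (intro solo_Suc[of "p - x"]) (use assms ledge_Arm_Wt in \<open>auto simp: algebra_simps\<close>)
  then show ?thesis by blast
qed

lemma branch_enabled:
  assumes "attainable (K + 3) (conf k)" "pc k < length P" "fits K (P ! pc k)"
    and small: "\<And>r. r \<le> K \<Longrightarrow> val k r < p"
  shows "\<exists>a m b. (a, m, b) \<in> branches (P ! pc k) \<and> m \<in> ops K \<and> pc (Suc k) = b \<and> changes k m \<and>
    attainable (K + 3) ((conf k)(K + 1 := (Snd m b, 0)))"
proof -
  have C: "conf k (K + 1) = (Ctl (pc k), 0)" by (simp add: conf_def)
  have eps: ?thesis if "(Eps, m, b) \<in> branches (P ! pc k)" "m \<in> ops K" for m b
    using attainable_eps[OF assms(1), of "K + 1" "(Snd m b, 0)"] ledge_branch(1)[OF assms(2) that(1)]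
      changes_branch[OF assms(2) that(1)] that C by auto
  \<comment> \<open>The counter process \<open>r\<close> answers the test and keeps its own state;
    the controller alone is selected as receiver.\<close>
  have recv: ?thesis
    if b: "(Recv q, m, b) \<in> branches (P ! pc k)" "m \<in> ops K" "r \<le> K"
      and q: "ledge (Bcast q) (Wt r, val k r) (Wt r, val k r)"
      and "\<And>r. Recv q = Recv (IsZero r) \<Longrightarrow> val k r = 0"
      "\<And>r. Recv q = Recv (NonZero r) \<Longrightarrow> val k r > 0" for q m b r
  proof -
    have w: "conf k r = (Wt r, val k r)" using b(3) by (simp add: conf_def)
    have "attainable (K + 3) (\<lambda>j. if j = r then (Wt r, val k r) else if j \<in> {K + 1} then (Snd m b, 0)
        else conf k j)"
      by (rule attainable_bcast[OF assms(1), of r q])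
        (use b q w C ledge_branch(1)[OF assms(2) b(1)] in auto)
    then have "attainable (K + 3) ((conf k)(K + 1 := (Snd m b, 0)))"
      by (rule attainable_cong) (use b(3) w in auto)
    then show ?thesis using changes_branch[OF assms(2) b(1)] that by blast
  qed
  show ?thesis
  proof (cases "P ! pc k")
    case (INC r b)
    then show ?thesis using eps[of "IncM (Suc r)" b] assms(3) by (simp add: ops_def)
  next
    case (JMP b)
    then show ?thesis using eps[of Nop b] by (simp add: ops_def)
  next
    case (JZD r a b)
    then have r: "Suc r \<le> K" using assms(3) by simp
    show ?thesis
    proof (cases "val k (Suc r) = 0")
      case True
      then show ?thesis
        using recv[of "IsZero (Suc r)" Nop a "Suc r"] JZD r ledge_IsZero[OF r] by (simp add: ops_def)
    next
      case False
      then show ?thesis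
        using recv[of "NonZero (Suc r)" "DecM (Suc r)" b "Suc r"] JZD r
          ledge_NonZero[OF r _ small[OF r]] by (simp add: ops_def)
    qed
  qed
qed

text \<open>One broadcast to all counters, then solo runs for \<open>p + 1\<close> time units. The
  target \<open>l\<close> of the step counter is left open, so that the lemma covers ordinary cycles
  and the overflowing one.\<close>

lemma attainable_cycle:
  assumes "attainable (K + 3) (conf k)" "pc k < length P" "fits K (P ! pc k)"
    and small: "\<And>r. r \<le> K \<Longrightarrow> val k r < p"
    and l: "\<exists>j. solo j (Arm 0 0, val k 0) (p + 1) l"
  shows "attainable (K + 3) ((conf (Suc k))(0 := l))"
proof -
  obtain a m b where b: "(a, m, b) \<in> branches (P ! pc k)" "m \<in> ops K" "pc (Suc k) = b" "changes k m"
    "attainable (K + 3) ((conf k)(K + 1 := (Snd m b, 0)))"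
    using branch_enabled[OF assms(1-3) small] by blast
  let ?f = "\<lambda>j. (Arm j (lag m j), real (val k j))"
  let ?w = "\<lambda>j. if j = K + 1 then (Lng b, 0) else if j \<in> {..K} then ?f j
      else ((conf k)(K + 1 := (Snd m b, 0))) j"
  have w: "attainable (K + 3) ?w"
  proof (rule attainable_bcast[OF b(5), of _ m])
    show "ledge (Bcast m) (((conf k)(K + 1 := (Snd m b, 0))) (K + 1)) (Lng b, 0)"
      using ledge_branch(2)[OF assms(2) b(1)] by simp
    fix j assume "j \<in> {..K}"
    then show "ledge (Recv m) (((conf k)(K + 1 := (Snd m b, 0))) j) (?f j)"
      using ledge_arm[OF _ b(2) small, of j] by (simp add: conf_def)
  qed auto
  show ?thesis
  proof (rule attainable_solo_runs[OF w])
    fix i assume i: "i < K + 3"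
    consider "i = 0" | "0 < i" "i \<le> K" | "i = K + 1" | "i = K + 2" using i by linarith
    then show "\<exists>j. solo j (?w i) (p + 1) (((conf (Suc k))(0 := l)) i)"
    proof cases
      case 1
      then show ?thesis using l by (simp add: lag_def)
    next
      case 2
      have "val (Suc k) i + lag m i = val k i + 1" using b(4) by (simp add: changes_def)
      then have "real (val (Suc k) i) + real (lag m i) = real (val k i) + 1"
        by (metis of_nat_1 of_nat_add)
      then show ?thesis using 2 solo_Arm[of i "val k i" "val (Suc k) i" m] small[of i]
        by (simp add: conf_def)
    next
      case 3
      have "solo (Suc (Suc 0)) (Lng b, 0) (p + 1) (Ctl b, 0)"
        by (rule solo_Suc[of p _ _ "(Lst b, 0)"], simp add: period_nonneg, simp add: ledge_branch(3)[OF assms(2) b(1)],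
            rule solo_Suc[of 1])
          (use ledge_branch(4)[OF assms(2) b(1)] in \<open>auto intro: solo_0\<close>)
      then show ?thesis using 3 b(3) by (auto simp: conf_def)
    next
      case 4
      then show ?thesis using p_nonneg by (auto simp: conf_def T_Suc intro!: exI[of _ 0] solo_0)
    qed
  qed (use p_nonneg in simp)
qed

text \<open>An instruction raises a register by at most 1, so the step counter dominates: while it
  is below \<open>p\<close>, all counters are.\<close>

lemma val_le: "val k r \<le> n + k"
proof (induction k arbitrary: r)
  case (Suc k)
  show ?case
  proof (cases r)
    case (Suc r')
    obtain i \<sigma> where m: "mconf k = (i, \<sigma>)" by (cases "mconf k")
    have S: "mconf (Suc k) = mnext P (i, \<sigma>)" by (simp add: m[symmetric] mconf_def)
    have "snd (mnext P (i, \<sigma>)) r' \<le> Suc (\<sigma> r')"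
      by (auto split: instr.split)
    then show ?thesis using Suc Suc.IH[of r] S m by (simp add: val_def)
  qed simp
qed simp

lemma attainable_conf:
  assumes "1 \<le> K" "\<And>I. I \<in> set P \<Longrightarrow> fits K I"
    and "\<And>j. j < k \<Longrightarrow> pc j < length P" "\<And>j. j < k \<Longrightarrow> n + j < p"
  shows "attainable (K + 3) (conf k)"
  using assms(3,4)
proof (induction k)
  case 0
  show ?case by (rule attainable_setup[OF assms(1)])
next
  case (Suc k)
  have small: "val k r < p" for r
  proof -
    have "real (val k r) \<le> n + k" using val_le[of k r] by linarith
    then show ?thesis using Suc.prems(2)[of k] by simp
  qed
  have "attainable (K + 3) ((conf (Suc k))(0 := (Wt 0, val (Suc k) 0)))"
  proof (rule attainable_cycle)
    show "attainable (K + 3) (conf k)" using Suc by auto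
    show "pc k < length P" "fits K (P ! pc k)" using Suc.prems(1)[of k] assms(2) by auto
    show "\<exists>j. solo j (Arm 0 0, val k 0) (p + 1) (Wt 0, val (Suc k) 0)"
      \<comment> \<open>Any message could stand for \<open>Nop\<close>, as the lag of counter 0 is
        always 0.\<close>
      using solo_Arm[of 0 "val k 0" "val (Suc k) 0" Nop] small[of 0] by (simp add: lag_def)
  qed (rule small)
  then show ?case by (rule attainable_cong) (simp add: conf_def)
qed

lemma attainable_reach:
  assumes "attainable N w" "i < N" "fst (w i) = s"
  shows "\<exists>C. (step (proto P K n) \<pi>)\<^sup>*\<^sup>* (init_config (proto P K n) N) C \<and> to_nat s \<in> fst ` set C"
proof -
  obtain C t where C: "(step (proto P K n) \<pi>)\<^sup>*\<^sup>* (init_config (proto P K n) N) C" "t \<ge> 0"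
    "length C = N" "\<forall>i<N. matches (delay t C ! i) (w i)"
    using assms(1) unfolding attainable_def by blast
  then have "fst (C ! i) = to_nat s"
    using assms(2,3) by (auto simp: matches_def delay_def split_beta)
  then have "to_nat s \<in> fst ` set C" using C(3) assms(2) by (metis image_eqI nth_mem)
  then show ?thesis using C(1) by blast
qed

lemma reach_Done:
  assumes "1 \<le> K" "\<And>I. I \<in> set P \<Longrightarrow> fits K I"
    and "pc h = length P" "\<And>j. j < h \<Longrightarrow> pc j < length P" "n + h \<le> p"
  shows "\<exists>C. (step (proto P K n) \<pi>)\<^sup>*\<^sup>* (init_config (proto P K n) (K + 3)) C \<and>
    to_nat Done \<in> fst ` set C"
proof -
  have "attainable (K + 3) (conf h)"
    by (rule attainable_conf[OF assms(1,2,4)]) (use assms(5) in auto)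
  then have "attainable (K + 3) ((conf h)(K + 1 := (Done, 0)))"
    by (rule attainable_eps) (use ledge_Done assms(3) in \<open>auto simp: conf_def\<close>)
  then show ?thesis by (rule attainable_reach[of _ _ "K + 1"]) auto
qed

text \<open>If \<open>p \<le> n\<close>, a process is \<open>Early\<close> when \<open>Start\<close>
  is sent. Otherwise the step counter reaches \<open>p\<close> later, and the controller, still
  inside the program, hears \<open>Overflow\<close> at the end of that cycle.\<close>

lemma reach_Over:
  assumes "1 \<le> K" "\<And>I. I \<in> set P \<Longrightarrow> fits K I" "\<And>j. pc j < length P"
  shows "\<exists>C. (step (proto P K n) \<pi>)\<^sup>*\<^sup>* (init_config (proto P K n) (K + 3)) C \<and>
    to_nat Over \<in> fst ` set C"
proof (cases "p \<le> n")
  case True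
  let ?w = "\<lambda>i. if i = K + 1 then (Pre, 0) else if i = K + 2 then (Early, real n) else (Init, real n)"
  have "attainable (K + 3) ?w"
  proof (rule attainable_solo_runs[OF attainable_init])
    fix i assume "i < K + 3"
    have "solo (Suc 0) (Init, 0) n (Pre, 0)"
      by (rule solo_Suc[of n]) (auto simp: ledge_input intro: solo_0)
    moreover have "solo (Suc 0) (Init, 0) n (Early, n)"
      by (rule solo_Suc[of p]) (use True ledge_Early p_nonneg in \<open>auto intro: solo_0\<close>)
    moreover have "solo 0 (Init, 0) n (Init, n)" by (auto intro: solo_0)
    ultimately show "\<exists>k. solo k (Init, 0) n (?w i)" by auto
  qed simp
  then have "attainable (K + 3) (\<lambda>j. if j = K + 1 then (Pre, 0) else if j \<in> {K + 2} then (Over, real n) else ?w j)"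
    by (rule attainable_bcast[of _ _ _ Start]) (auto simp: ledge_Start ledge_Start_Over)
  then show ?thesis by (rule attainable_reach[of _ _ "K + 2"]) auto
next
  case False
  \<comment> \<open>The first overflow. It is positive because \<open>n < p\<close>, so the faithful
    run reaches \<open>j = k - 1\<close>, and cycle \<open>j\<close> ends in
    \<open>Full\<close>.\<close>
  define k where "k = (LEAST k. p \<le> n + k)"
  obtain k0 :: nat where "p \<le> k0" using real_arch_simple by blast
  then have "p \<le> n + k0" by simp
  then have k: "p \<le> n + k" "\<And>j. j < k \<Longrightarrow> n + j < p"
    unfolding k_def by (rule LeastI, metis not_less_Least not_le)
  then obtain j where j: "k = Suc j" using False by (cases k) auto
  have small: "val j r < p" for r
  proof -
    have "real (val j r) \<le> n + j" using val_le[of j r] by linarith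
    then show ?thesis using k(2)[of j] j by simp
  qed
  let ?l = "(Full, real (n + j) + 1 - p)"
  let ?w = "(conf (Suc j))(0 := ?l)"
  have "attainable (K + 3) ?w"
  proof (rule attainable_cycle)
    show "attainable (K + 3) (conf j)" by (rule attainable_conf[OF assms(1,2,3)]) (use k(2) j in auto)
    show "pc j < length P" "fits K (P ! pc j)" using assms(2,3) by auto
    show "\<exists>i. solo i (Arm 0 0, val j 0) (p + 1) ?l"
      using solo_Arm_Full[of "val j 0"] small[of 0] k(1) j by simp
  qed (rule small)
  then have "attainable (K + 3) (\<lambda>i. if i = 0 then ?l else if i \<in> {K + 1} then (Over, 0) else ?w i)"
    by (rule attainable_bcast[of _ _ _ Overflow])
      (use small[of 0] assms(3) in \<open>auto simp: conf_def ledge_Overflow ledge_Ctl_Over\<close>)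
  then show ?thesis by (rule attainable_reach[of _ _ "K + 1"]) auto
qed

end

section \<open>Undecidability\<close>

abbreviation mpc :: "instr list \<Rightarrow> nat \<Rightarrow> nat \<Rightarrow> nat" where
  "mpc P n k \<equiv> fst ((mnext P ^^ k) (0, start_regs n))"

lemma existence_if_halts:
  assumes "1 \<le> K" "\<And>I. I \<in> set P \<Longrightarrow> fits K I" "mpc P n k = length P"
  shows "EF_existence (proto P K n, to_nat Done)"
proof -
  \<comment> \<open>The first step outside the program. Configurations stay fixed from there on, so
    its position is the one at \<open>k\<close>.\<close>
  define h where "h = (LEAST j. \<not> mpc P n j < length P)"
  have h: "\<not> mpc P n h < length P" "h \<le> k"
    unfolding h_def using assms(3) LeastI[of "\<lambda>j. \<not> mpc P n j < length P" k]
      Least_le[of "\<lambda>j. \<not> mpc P n j < length P" k] by simp_all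
  have before: "mpc P n j < length P" if "j < h" for j
    using not_less_Least that unfolding h_def by blast
  have halted: "mpc P n h = length P"
    using mnext_halted[OF h(1), of "k - h"] h(2) assms(3) by simp
  \<comment> \<open>The value \<open>n + h\<close> exceeds the step counter at each of the
    \<open>h\<close> instructions.\<close>
  interpret simulation P K n "\<lambda>_. of_nat (n + h)" by unfold_locales simp
  have "\<exists>C. (step (proto P K n) (\<lambda>_. of_nat (n + h)))\<^sup>*\<^sup>* (init_config (proto P K n) (K + 3)) C \<and>
      to_nat Done \<in> fst ` set C"
    by (rule reach_Done[of h]) (use assms before halted in \<open>auto simp: pc_def mconf_def of_rat_add\<close>)
  moreover have "(\<lambda>_. of_nat (n + h)) \<in> param_vals (proto P K n)"
    by (auto simp: param_vals_def)
  ultimately show ?thesis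
    unfolding EF_existence_def prod.case reaches_iff by blast
qed

lemma halts_if_existence:
  assumes "EF_existence (proto P K n, to_nat Done)"
  shows "\<exists>k. mpc P n k = length P"
proof -
  from assms obtain N \<pi> C where \<pi>: "\<pi> \<in> param_vals (proto P K n)"
    and C: "(step (proto P K n) \<pi>)\<^sup>*\<^sup>* (init_config (proto P K n) N) C" "to_nat Done \<in> fst ` set C"
    unfolding EF_existence_def prod.case reaches_iff by blast
  from \<pi> interpret simulation P K n \<pi>
    by unfold_locales (auto simp: param_vals_def proto_def)
  obtain t where t: "\<forall>l\<in>set C. linv t l" using linv_reachable[OF C(1)] by blast
  obtain l where "l \<in> set C" "fst l = to_nat Done" using C(2) by auto
  with t have "inv t Done (snd l 0)" by (force simp: linv_def)
  then show ?thesis by (simp add: pc_def mconf_def)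
qed

lemma universality_if_diverges:
  assumes "1 \<le> K" "\<And>I. I \<in> set P \<Longrightarrow> fits K I" "\<And>k. mpc P n k < length P"
  shows "EF_universality (proto P K n, to_nat Over)"
  unfolding EF_universality_def prod.case reaches_iff
proof (intro exI[of _ "K + 3"] ballI)
  fix \<pi> assume "\<pi> \<in> param_vals (proto P K n)"
  then interpret simulation P K n \<pi>
    by unfold_locales (auto simp: param_vals_def proto_def)
  show "\<exists>C. (step (proto P K n) \<pi>)\<^sup>*\<^sup>* (init_config (proto P K n) (K + 3)) C \<and>
      to_nat Over \<in> fst ` set C"
    by (rule reach_Over) (use assms in \<open>auto simp: pc_def mconf_def\<close>)
qed

lemma not_universality_if_halts:
  assumes "mpc P n k = length P"
  shows "\<not> EF_universality (proto P K n, to_nat Over)"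
proof
  assume "EF_universality (proto P K n, to_nat Over)"
  \<comment> \<open>With this value an overflow needs more than \<open>k\<close> steps, but the
    machine has halted by step \<open>k\<close>.\<close>
  moreover define \<pi> :: "nat \<Rightarrow> rat" where "\<pi> = (\<lambda>_. of_nat (n + k + 1))"
  moreover have "\<pi> \<in> param_vals (proto P K n)" by (auto simp: param_vals_def \<pi>_def)
  ultimately obtain N C where
    C: "(step (proto P K n) \<pi>)\<^sup>*\<^sup>* (init_config (proto P K n) N) C" "to_nat Over \<in> fst ` set C"
    unfolding EF_universality_def prod.case reaches_iff by blast
  interpret simulation P K n \<pi> by unfold_locales (simp add: \<pi>_def)
  obtain t where t: "\<forall>l\<in>set C. linv t l" using linv_reachable[OF C(1)] by blast
  obtain l where "l \<in> set C" "fst l = to_nat Over" using C(2) by auto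
  with t have "inv t Over (snd l 0)" by (force simp: linv_def)
  then obtain j where j: "active j" "p \<le> real (n + j)" unfolding inv.simps by blast
  have "p = real (n + k + 1)" unfolding \<pi>_def by (rule of_rat_of_nat_eq)
  with j(2) have "k < j" by linarith
  with j(1) assms show False by (auto simp: active_def pc_def mconf_def)
qed

section \<open>Well-formedness and computable codes of the instances\<close>

lemma finite_fixed_edges: "finite (fixed_edges P K)"
proof -
  have "finite (branches I)" for I by (cases I) auto
  then have "finite (control_edges i I)" for i I by (auto simp: control_edges_def)
  moreover have "finite (counter_edges K r)" for r by (simp add: counter_edges_def ops_def)
  ultimately show ?thesis by (simp add: fixed_edges_def setup_edges_def)
qed

lemma member_le_list_encode: "x \<in> set xs \<Longrightarrow> x \<le> list_encode xs"
proof (induction xs)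
  case (Cons y ys)
  then show ?case
    using le_prod_encode_1[of y "list_encode ys"] le_prod_encode_2[of "list_encode ys" y] by auto
qed simp

lemma member_le_set_encode:
  assumes "finite A" "x \<in> A"
  shows "x \<le> set_encode A"
proof -
  have "(2::nat) ^ x \<le> set_encode A"
    unfolding set_encode_def using assms by (intro member_le_sum) auto
  then show ?thesis using less_exp[of x] by linarith
qed

text \<open>A list code bounds its entries and a set code its elements, so the code of the edge set
  bounds the names inside the edges.\<close>

lemma edge_le_fixed_code:
  assumes "(s, g, a, u, s') \<in> fixed_edges P K"
  shows "to_nat s \<le> fixed_code P K" "to_nat s' \<le> fixed_code P K"
    "set_act (map_act to_nat a) \<subseteq> {..fixed_code P K}"
proof -
  let ?e = "concrete (s, g, a, u, s')"
  have "edge_code ?e \<in> edge_code ` concrete ` fixed_edges P K" using assms by blast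
  then have "edge_code ?e \<le> fixed_code P K"
    unfolding fixed_code_def using finite_fixed_edges by (intro member_le_set_encode) auto
  moreover have "x \<le> edge_code ?e" if "x \<in> {to_nat s, to_nat s', act_code (map_act to_nat a)}" for x
    unfolding edge_code_def concrete_def prod.case
    by (rule member_le_list_encode) (use that in auto)
  ultimately have le: "x \<le> fixed_code P K"
    if "x \<in> {to_nat s, to_nat s', act_code (map_act to_nat a)}" for x
    using that order_trans by blast
  then show "to_nat s \<le> fixed_code P K" "to_nat s' \<le> fixed_code P K" by blast+
  show "set_act (map_act to_nat a) \<subseteq> {..fixed_code P K}"
    using le[of "act_code (map_act to_nat a)"] by (cases a) auto
qed

lemma guard_in_fixed_edges:
  assumes "(s, g, a, u, s') \<in> fixed_edges P K" "(c, b) \<in> set g"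
  shows "bound_in {0} b"
  using assms unfolding fixed_edges_def setup_edges_def counter_edges_def control_edges_def
  by auto

lemma setup_states_le:
  "to_nat Init \<le> fixed_code P K" "to_nat Pre \<le> fixed_code P K"
  "to_nat Over \<le> fixed_code P K" "to_nat Done \<le> fixed_code P K"
proof -
  have "(Init, [(Eq, Const 0)], Eps, False, Wt 0) \<in> fixed_edges P K"
    "(Pre, [(Eq, Const 0)], Eps, False, Ctl 0) \<in> fixed_edges P K"
    "(Early, [], Recv Start, False, Over) \<in> fixed_edges P K"
    "(Ctl (length P), [], Eps, False, Done) \<in> fixed_edges P K"
    by (simp_all add: fixed_edges_def setup_edges_def)
  from this[THEN edge_le_fixed_code(1)] this[THEN edge_le_fixed_code(2)]
  show "to_nat Init \<le> fixed_code P K" "to_nat Pre \<le> fixed_code P K"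
    "to_nat Over \<le> fixed_code P K" "to_nat Done \<le> fixed_code P K" by auto
qed

lemma wf_proto: "wf_ptbp (proto P K n)"
proof -
  have "wf_edge (proto P K n) (concrete z)" if z: "z \<in> insert (input_edge n) (fixed_edges P K)" for z
  proof (cases "z = input_edge n")
    case True
    then show ?thesis
      using setup_states_le by (simp add: wf_edge_def concrete_def input_edge_def proto_def)
  next
    case False
    obtain s g a u s' where zs: "z = (s, g, a, u, s')" by (metis prod_cases5)
    then have "(s, g, a, u, s') \<in> fixed_edges P K" using z False by simp
    note * = edge_le_fixed_code[OF this] guard_in_fixed_edges[OF this]
    show ?thesis
      using * by (auto simp: wf_edge_def concrete_def zs proto_def)
  qed
  then show ?thesis
    using finite_fixed_edges setup_states_le by (auto simp: wf_ptbp_def proto_def)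
qed

lemma proto_instance:
  "s \<in> {Over, Done} \<Longrightarrow> (proto P K n, to_nat s) \<in> one_clock_instances"
  using wf_proto setup_states_le unfolding one_clock_instances_def by (auto simp: proto_def)

text \<open>\<open>A\<close> codes the set of fixed edges, so inserting an edge with code
  \<open>e\<close> adds \<open>2 ^ e\<close>. The rational \<open>n\<close> is the fraction
  \<open>n / 1\<close>, whose parts have the integer codes \<open>n + n\<close> and 2; the pair code
  is doubled by the coding of \<open>Const\<close>.\<close>

definition code_of :: "nat \<Rightarrow> nat \<Rightarrow> nat \<Rightarrow> nat" where
  "code_of q A n = list_encode [set_encode {..A}, set_encode {0}, set_encode {..A}, set_encode {0},
     to_nat Init,
     A + 2 ^ list_encode [to_nat Init,
        list_encode [prod_encode (0, prod_encode (2, prod_encode (n + n, 2) + prod_encode (n + n, 2)))],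
        0, set_encode {0}, to_nat Pre], q]"

lemma instance_code_proto:
  "instance_code (proto P K n, q) = code_of q (fixed_code P K) n"
proof -
  let ?F = "edge_code ` concrete ` fixed_edges P K"
  \<comment> \<open>The input edge is the only one from \<open>Init\<close> to \<open>Pre\<close>.
    So its code is new to the set, and inserting it is an addition.\<close>
  have "(Init, g, a, u, Pre) \<notin> fixed_edges P K" for g a u
    unfolding fixed_edges_def setup_edges_def counter_edges_def control_edges_def by auto
  then have new: "concrete (input_edge n) \<notin> concrete ` fixed_edges P K"
    by (auto simp: concrete_def input_edge_def)
  have "concrete z \<in> {(q, g, a, U, q'). finite U}" for z
    by (simp add: concrete_def split: prod.split)
  then have "concrete z = concrete z'" if "edge_code (concrete z) = edge_code (concrete z')" for z z'
    by (rule inj_onD[OF inj_on_edge_code that]) fact+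
  then have "edge_code (concrete (input_edge n)) \<notin> ?F"
    using new by blast
  then have "set_encode (edge_code ` edges (proto P K n)) =
      fixed_code P K + 2 ^ edge_code (concrete (input_edge n))"
    using finite_fixed_edges by (simp add: proto_def fixed_code_def set_encode_insert)
  moreover have "quotient_of (of_nat n) = (int n, 1)"
    using quotient_of_int[of "int n"] by (simp add: of_int_of_nat_eq)
  then have "edge_code (concrete (input_edge n)) = list_encode [to_nat Init,
      list_encode [prod_encode (0, prod_encode (2, prod_encode (n + n, 2) + prod_encode (n + n, 2)))],
      0, set_encode {0}, to_nat Pre]"
    by (simp add: edge_code_def concrete_def input_edge_def guard_code_def int_encode_def
        sum_encode_def mult_2 del: list_encode.simps)
  ultimately show ?thesis
    by (simp add: instance_code_def code_of_def proto_def del: list_encode.simps)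
qed

lemma computable_code_of: "computable 1 (\<lambda>xs. code_of q (xs ! 0) (xs ! 0))"
  unfolding code_of_def
  by (intro computable_list_encode_Cons computable_list_encode_Nil computable_set_encode_atMost
      computable_const computable_add computable_pow2 computable_prod_encode computable_proj) auto

lemma fits_exists: "\<exists>K\<ge>1. \<forall>I\<in>set P. fits K I"
proof -
  have mono: "fits K I \<Longrightarrow> K \<le> L \<Longrightarrow> fits L I" for K L I by (cases I) auto
  have "\<exists>K. fits K I" for I by (cases I) auto
  then obtain k where k: "\<And>I. fits (k I) I" by metis
  have "fits (Suc (\<Sum>I\<in>set P. k I)) I" if "I \<in> set P" for I
    using mono[OF k] member_le_sum[OF that, of k] by auto
  then show ?thesis by (intro exI[of _ "Suc (\<Sum>I\<in>set P. k I)"]) auto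
qed

text \<open>The program answers the opposite of the alleged decision algorithm on the instance that
  runs it on the number \<open>fixed_code P K\<close>, from which this very instance can be computed.\<close>

lemma undecidable_question:
  assumes "s \<in> {Over, Done}"
    and halts: "\<And>P K n k. 1 \<le> K \<Longrightarrow> (\<And>I. I \<in> set P \<Longrightarrow> fits K I) \<Longrightarrow> mpc P n k = length P \<Longrightarrow>
      Q (proto P K n, to_nat s) = v"
    and diverges: "\<And>P K n. 1 \<le> K \<Longrightarrow> (\<And>I. I \<in> set P \<Longrightarrow> fits K I) \<Longrightarrow>
      (\<And>k. mpc P n k < length P) \<Longrightarrow> Q (proto P K n, to_nat s) = (\<not> v)"
  shows "\<not> decidable_problem instance_code one_clock_instances Q"
proof
  assume "decidable_problem instance_code one_clock_instances Q"
  then obtain f where f: "\<And>x. x \<in> one_clock_instances \<Longrightarrow>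
      computes f [instance_code x] (if Q x then 1 else 0)"
    unfolding decidable_problem_def by blast
  \<comment> \<open>The machine halts iff its result is 0, and halting makes the answer
    \<open>v\<close>. So \<open>h\<close> sends exactly the answer opposite to \<open>v\<close> to
    0.\<close>
  define h :: "nat \<Rightarrow> nat" where "h y = (if v then y else if y = 0 then 1 else 0)" for y
  have "computable 1 (\<lambda>xs. h (xs ! 0))"
  proof (cases v)
    case True
    then show ?thesis using computable_proj[of 0 1] by (simp add: h_def)
  next
    case False
    then show ?thesis
      using computable_rec[of h "\<lambda>_ _. 0"] computable_const by (simp add: h_def)
  qed
  then obtain g where g: "\<And>y. computes g [y] (h y)"
    unfolding computable_def by (metis length_Cons list.size(3) nth_Cons_0 One_nat_def)
  obtain c where c: "\<And>n. computes c [n] (code_of (to_nat s) n n)"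
    using computable_code_of[of "to_nat s"]
    unfolding computable_def by (metis length_Cons list.size(3) nth_Cons_0 One_nat_def)
  obtain P where P: "\<And>n y. computes (Comp g [Comp f [c]]) [n] y \<Longrightarrow>
      (if y = 0 then \<exists>k. mpc P n k = length P else \<forall>k. mpc P n k < length P)"
    using machine_exists by blast
  obtain K where K: "1 \<le> K" "\<And>I. I \<in> set P \<Longrightarrow> fits K I" using fits_exists by blast
  let ?n = "fixed_code P K"
  let ?x = "(proto P K ?n, to_nat s)"
  let ?y = "if Q ?x then 1 else 0 :: nat"
  have "computes c [?n] (instance_code ?x)" using c by (simp add: instance_code_proto)
  \<comment> \<open>On this input \<open>c\<close> yields the code of an instance, so
    \<open>f\<close> is defined there and answers correctly.\<close>
  then have "computes (Comp g [Comp f [c]]) [?n] (h ?y)"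
    by (intro computes_comp1[OF computes_comp1[OF _ f[OF proto_instance[OF assms(1)]]] g])
  note P = P[OF this]
  show False
  proof (cases "h ?y = 0")
    case True
    then obtain k where "mpc P ?n k = length P" using P by auto
    then have "Q ?x = v" using halts[of K P k ?n] K by blast
    then show False using True by (auto simp: h_def split: if_splits)
  next
    case False
    then have "\<And>k. mpc P ?n k < length P" using P by auto
    then have "Q ?x = (\<not> v)" using diverges[of K P ?n] K by blast
    then show False using False by (auto simp: h_def split: if_splits)
  qed
qed

theorem theorem3:
  "\<not> decidable_problem instance_code one_clock_instances EF_existence \<and>
   \<not> decidable_problem instance_code one_clock_instances EF_universality"
proof
  show "\<not> decidable_problem instance_code one_clock_instances EF_existence"
  proof (rule undecidable_question[where s = Done and v = True])
    fix P K n assume "\<And>k. mpc P n k < length P"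
    then show "EF_existence (proto P K n, to_nat Done) = (\<not> True)"
      using halts_if_existence by (metis less_irrefl)
  qed (use existence_if_halts in auto)
  show "\<not> decidable_problem instance_code one_clock_instances EF_universality"
    by (rule undecidable_question[where s = Over and v = False])
      (use universality_if_diverges not_universality_if_halts in auto)
qed

end
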